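(* Let $(k,D_k)$ be a differential field, let $(K,D_K)$ be a parameterized differential field over $(k,D_k)$, and let $N$ be a finite-dimensional $D_{K/k}$-module over $K$. Suppose that $(k,D_k)$ is filtered-linearly closed. Then $N$ is isomonodromic if and only if there is a (possibly, non-commuting) basis $\partial_1,\ldots,\partial_d$ of $D_k$ over $k$ such that $N$ is $\partial_i$-isomonodromic for all $i$, $1\leqslant i\leqslant d$.
   Context: Differential field: a pair $(k,D_k)$, where $k$ is a field of characteristic zero and $D_k$ is a finite-dimensional $k$-vector space with a Lie bracket (additive, not necessarily $k$-linear) and a $k$-linear homomorphism of Lie rings $D_k\to\mathrm{Der}(k,k)$ (not necessarily injective) such that $[\partial,a\delta]=a[\partial,\delta]+\partial(a)\delta$ for all $a\in k$, $\partial,\delta\in D_k$. The elements annihilated by $D_k$ are denoted by the superscript $D_k$. A $D_k$-module is a $k$-vector space $M$ with an action $D_k\times M\to M$ that is biadditive, $k$-linear in $D_k$, satisfies $\partial(am)=\partial(a)m+a\partial(m)$ and $[\partial,\delta]m=\partial(\delta m)-\delta(\partial m)$. It is trivial if the natural map $k\otimes_{k^{D_k}}M^{D_k}\to M$ is an isomorphism. Any $k$-subspace $D\subset D_k$ closed under the bracket gives a differential field $(k,D)$; $k$ is linearly $D$-closed if all finite-dimensional $D$-modules over $k$ are trivial. Filtered-linearly closed: $(k,D_k)$ is filtered-linearly closed if there is a sequence of $k$-subspaces closed under the Lie bracket $0=D_0\subset D_1\subset\ldots\subset D_{d}=D_k$ with $\dim_k(D_{i+1}/D_i)=1$ and $k$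 linearly $D_i$-closed for all $i$, $0\leqslant i\leqslant d-1$ (it is not required that $k$ be linearly $D_k$-closed). Morphism of differential fields $(k,D_k)\to(K,D_K)$: a field homomorphism $k\to K$ together with a $K$-linear map $D_K\to K\otimes_kD_k$ (the structure map) such that if $\delta\mapsto\sum_i b_i\otimes\partial_i$ then $\delta(a)=\sum_i b_i\partial_i(a)$ for all $a\in k$, and such that the homomorphism of exterior algebras induced by the dual map $D_k^\vee\to D_K^\vee$ commutes with the de Rham differentials (that is, the structure map is compatible with the brackets). Parameterized differential field over $(k,D_k)$: a differential field $(K,D_K)$ with a morphism $(k,D_k)\to (K,D_K)$ whose structure map $D_K\to K\otimes_kD_k$ is surjective and such that $K^{D_{K/k}}=k$, where $D_{K/k}$ is the kernel of the structure map (so $(K,D_{K/k})$ is a differential field). Isomonodromic: a finite-dimensional $D_{K/k}$-module $N$ over $K$ is isomonodromic if there is a $D_K$-module structure on $N$ whose restriction from $D_K$ to $D_{K/k}$ is the given $D_{K/k}$-structure. For $\partial\in D_k$, let $D_{K,\partial}\subset D_K$ be the preimage of $K\otimes\partial$ under the structure map; $N$ is $\partial$-isomonodromic if there is a $D_{K,\partial}$-module structure on $N$ whose restriction to $D_{K/k}$ is the given one. *)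

theory Defs
  imports Complex_Main "HOL-Algebra.Free_Abelian_Groups" "HOL-Library.Function_Algebras"
begin

section \<open>Extension of scalars\<close>

text \<open>
  For a set \<open>R\<close> of scalars, an embedding \<open>\<phi>\<close> of \<open>R\<close> into a field \<open>'a\<close> and an \<open>R\<close>-module \<open>V\<close>
  with scalar multiplication \<open>sc\<close>, the tensor product of \<open>'a\<close> and \<open>V\<close> over \<open>R\<close> is the quotient of
  the free abelian group on pairs by the usual bilinearity relations. The library writes the group
  operations of this quotient multiplicatively, so its operation and its unit are the sum and the
  zero of the tensor product.
\<close>

definition tensor_relations ::
  "'r set \<Rightarrow> ('r \<Rightarrow> 'a::field) \<Rightarrow> 'v::ab_group_add set \<Rightarrow> ('r \<Rightarrow> 'v \<Rightarrow> 'v) \<Rightarrow> ('a \<times> 'v \<Rightarrow>\<^sub>0 int) set" where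
  "tensor_relations R \<phi> V sc =
     {frag_of (a + b, v) - frag_of (a, v) - frag_of (b, v) | a b v. v \<in> V}
   \<union> {frag_of (a, v + w) - frag_of (a, v) - frag_of (a, w) | a v w. v \<in> V \<and> w \<in> V}
   \<union> {frag_of (a * \<phi> r, v) - frag_of (a, sc r v) | a r v. r \<in> R \<and> v \<in> V}"

definition tensor_kernel ::
  "'r set \<Rightarrow> ('r \<Rightarrow> 'a::field) \<Rightarrow> 'v::ab_group_add set \<Rightarrow> ('r \<Rightarrow> 'v \<Rightarrow> 'v) \<Rightarrow> ('a \<times> 'v \<Rightarrow>\<^sub>0 int) set" where
  "tensor_kernel R \<phi> V sc =
     generate (free_Abelian_group (UNIV \<times> V)) (tensor_relations R \<phi> V sc)"

definition tensor ::
  "'r set \<Rightarrow> ('r \<Rightarrow> 'a::field) \<Rightarrow> 'v::ab_group_add set \<Rightarrow> ('r \<Rightarrow> 'v \<Rightarrow> 'v) \<Rightarrow> ('a \<times> 'v \<Rightarrow>\<^sub>0 int) set monoid" where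
  "tensor R \<phi> V sc = free_Abelian_group (UNIV \<times> V) Mod tensor_kernel R \<phi> V sc"

definition tensor_class ::
  "'r set \<Rightarrow> ('r \<Rightarrow> 'a::field) \<Rightarrow> 'v::ab_group_add set \<Rightarrow> ('r \<Rightarrow> 'v \<Rightarrow> 'v)
     \<Rightarrow> ('a \<times> 'v \<Rightarrow>\<^sub>0 int) \<Rightarrow> ('a \<times> 'v \<Rightarrow>\<^sub>0 int) set" where
  "tensor_class R \<phi> V sc x = tensor_kernel R \<phi> V sc #>\<^bsub>free_Abelian_group (UNIV \<times> V)\<^esub> x"

text \<open>
  An arbitrary representative of a tensor. Every function below that is defined through it
  is independent of the choice.
\<close>

definition rep :: "('a \<times> 'v \<Rightarrow>\<^sub>0 int) set \<Rightarrow> ('a \<times> 'v \<Rightarrow>\<^sub>0 int)" where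
  "rep t = (SOME x. x \<in> t)"

definition tensor_scale ::
  "'r set \<Rightarrow> ('r \<Rightarrow> 'a::field) \<Rightarrow> 'v::ab_group_add set \<Rightarrow> ('r \<Rightarrow> 'v \<Rightarrow> 'v)
     \<Rightarrow> 'a \<Rightarrow> ('a \<times> 'v \<Rightarrow>\<^sub>0 int) set \<Rightarrow> ('a \<times> 'v \<Rightarrow>\<^sub>0 int) set" where
  "tensor_scale R \<phi> V sc c t =
     tensor_class R \<phi> V sc (frag_extend (\<lambda>(b, v). frag_of (c * b, v)) (rep t))"


section \<open>Differential fields and differential modules\<close>

text \<open>
  The derivation space \<open>D\<^sub>k\<close> of a differential field \<open>(k, D\<^sub>k)\<close> is the whole type \<open>'d\<close>; its addition
  is that of the type, and \<open>der\<close> is the structure map to the derivations of \<open>k\<close>.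
\<close>

record ('k, 'd) derivation_space =
  scl :: "'k \<Rightarrow> 'd \<Rightarrow> 'd"
  brk :: "'d \<Rightarrow> 'd \<Rightarrow> 'd"
  der :: "'d \<Rightarrow> 'k \<Rightarrow> 'k"

definition finite_dim :: "('k::field \<Rightarrow> 'v::ab_group_add \<Rightarrow> 'v) \<Rightarrow> 'v set \<Rightarrow> bool" where
  "finite_dim sc V \<longleftrightarrow> (\<exists>B. finite B \<and> B \<subseteq> V \<and> V \<subseteq> module.span sc B)"

locale differential_field =
  fixes E :: "('k::field_char_0, 'd::ab_group_add) derivation_space"
  assumes vector_space: "vector_space (scl E)"
    and finite_dim: "finite_dim (scl E) UNIV"
    and brk_add_left: "brk E (\<eta> + \<eta>') \<delta> = brk E \<eta> \<delta> + brk E \<eta>' \<delta>"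
    and brk_add_right: "brk E \<delta> (\<eta> + \<eta>') = brk E \<delta> \<eta> + brk E \<delta> \<eta>'"
    and brk_self: "brk E \<eta> \<eta> = 0"
    and jacobi: "brk E \<eta> (brk E \<delta> \<epsilon>) + brk E \<delta> (brk E \<epsilon> \<eta>) + brk E \<epsilon> (brk E \<eta> \<delta>) = 0"
    and der_sum: "der E \<eta> (a + b) = der E \<eta> a + der E \<eta> b"
    and der_prod: "der E \<eta> (a * b) = der E \<eta> a * b + a * der E \<eta> b"
    and der_add: "der E (\<eta> + \<delta>) a = der E \<eta> a + der E \<delta> a"
    and der_scl: "der E (scl E c \<eta>) a = c * der E \<eta> a"
    and der_brk: "der E (brk E \<eta> \<delta>) a = der E \<eta> (der E \<delta> a) - der E \<delta> (der E \<eta> a)"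
    and brk_scl: "brk E \<eta> (scl E a \<delta>) = scl E a (brk E \<eta> \<delta>) + scl E (der E \<eta> a) \<delta>"

text \<open>
  The subspaces \<open>D\<close> of \<open>D\<^sub>k\<close> for which \<open>(k, D)\<close> is again a differential field.
\<close>

definition lie_subspace :: "('k::field_char_0, 'd::ab_group_add) derivation_space \<Rightarrow> 'd set \<Rightarrow> bool" where
  "lie_subspace E D \<longleftrightarrow>
     module.subspace (scl E) D \<and> (\<forall>\<eta>\<in>D. \<forall>\<delta>\<in>D. brk E \<eta> \<delta> \<in> D)"

definition constants :: "('k::field_char_0, 'd::ab_group_add) derivation_space \<Rightarrow> 'd set \<Rightarrow> 'k set" where
  "constants E D = {a. \<forall>\<eta>\<in>D. der E \<eta> a = 0}"

text \<open>
  Differential modules over \<open>(k, D)\<close>. The underlying \<open>k\<close>-space is a subspace \<open>M\<close> of some ambient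
  \<open>k\<close>-space; only the values of \<open>act\<close> on \<open>D\<close> and \<open>M\<close> matter.
\<close>

locale differential_module =
  fixes E :: "('k::field_char_0, 'd::ab_group_add) derivation_space"
    and D :: "'d set"
    and sc :: "'k \<Rightarrow> 'm::ab_group_add \<Rightarrow> 'm"
    and M :: "'m set"
    and act :: "'d \<Rightarrow> 'm \<Rightarrow> 'm"
  assumes vector_space: "vector_space sc"
    and subspace: "module.subspace sc M"
    and act_closed: "\<lbrakk>\<eta> \<in> D; m \<in> M\<rbrakk> \<Longrightarrow> act \<eta> m \<in> M"
    and act_add_left: "\<lbrakk>\<eta> \<in> D; \<delta> \<in> D; m \<in> M\<rbrakk> \<Longrightarrow> act (\<eta> + \<delta>) m = act \<eta> m + act \<delta> m"
    and act_add_right: "\<lbrakk>\<eta> \<in> D; m \<in> M; n \<in> M\<rbrakk> \<Longrightarrow> act \<eta> (m + n) = act \<eta> m + act \<eta> n"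
    and act_scl: "\<lbrakk>\<eta> \<in> D; m \<in> M\<rbrakk> \<Longrightarrow> act (scl E a \<eta>) m = sc a (act \<eta> m)"
    and act_leibniz: "\<lbrakk>\<eta> \<in> D; m \<in> M\<rbrakk> \<Longrightarrow> act \<eta> (sc a m) = sc (der E \<eta> a) m + sc a (act \<eta> m)"
    and act_brk: "\<lbrakk>\<eta> \<in> D; \<delta> \<in> D; m \<in> M\<rbrakk> \<Longrightarrow>
      act (brk E \<eta> \<delta>) m = act \<eta> (act \<delta> m) - act \<delta> (act \<eta> m)"

definition horizontal :: "'d set \<Rightarrow> 'm::ab_group_add set \<Rightarrow> ('d \<Rightarrow> 'm \<Rightarrow> 'm) \<Rightarrow> 'm set" where
  "horizontal D M act = {m \<in> M. \<forall>\<eta>\<in>D. act \<eta> m = 0}"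

text \<open>The map \<open>a \<otimes> m \<mapsto> a m\<close>.\<close>

definition natural_map ::
  "('k::field \<Rightarrow> 'm::ab_group_add \<Rightarrow> 'm) \<Rightarrow> ('k \<times> 'm \<Rightarrow>\<^sub>0 int) set \<Rightarrow> 'm" where
  "natural_map sc t =
     (\<Sum>(a, m)\<in>Poly_Mapping.keys (rep t). sc (of_int (Poly_Mapping.lookup (rep t) (a, m)) * a) m)"

definition trivial_module ::
  "('k::field_char_0, 'd::ab_group_add) derivation_space \<Rightarrow> 'd set
     \<Rightarrow> ('k \<Rightarrow> 'm::ab_group_add \<Rightarrow> 'm) \<Rightarrow> 'm set \<Rightarrow> ('d \<Rightarrow> 'm \<Rightarrow> 'm) \<Rightarrow> bool" where
  "trivial_module E D sc M act \<longleftrightarrow>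
     bij_betw (natural_map sc) (carrier (tensor (constants E D) id (horizontal D M act) sc)) M"

text \<open>
  HOL cannot quantify over types inside a definition. Since every finite-dimensional \<open>k\<close>-space is
  isomorphic to a subspace of the space of sequences in \<open>k\<close>, the finite-dimensional subspaces
  of the latter, with all possible actions, represent all finite-dimensional modules.
\<close>

definition linearly_closed :: "('k::field_char_0, 'd::ab_group_add) derivation_space \<Rightarrow> 'd set \<Rightarrow> bool" where
  "linearly_closed E D \<longleftrightarrow>
     (\<forall>M act. let sc = (\<lambda>(a::'k) (v::nat \<Rightarrow> 'k) i. a * v i) in
        differential_module E D sc M act \<and> finite_dim sc M \<longrightarrow> trivial_module E D sc M act)"

definition filtered_linearly_closed :: "('k::field_char_0, 'd::ab_group_add) derivation_space \<Rightarrow> bool" where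
  "filtered_linearly_closed E \<longleftrightarrow>
     (\<exists>(d::nat) D.
        (\<forall>i\<le>d. lie_subspace E (D i)) \<and> D 0 = {0} \<and> D d = UNIV \<and>
        (\<forall>i<d. D i \<subseteq> D (Suc i)
             \<and> vector_space.dim (scl E) (D (Suc i)) = vector_space.dim (scl E) (D i) + 1
             \<and> linearly_closed E (D i)))"


section \<open>Differential forms\<close>

text \<open>
  The \<open>p\<close>-th exterior power of \<open>D\<^sub>k\<^sup>\<or>\<close> is the space of alternating \<open>k\<close>-multilinear \<open>p\<close>-forms on \<open>D\<^sub>k\<close>;
  a \<open>p\<close>-form takes lists of length \<open>p\<close>.
\<close>

definition diff_form ::
  "('k::field_char_0, 'd::ab_group_add) derivation_space \<Rightarrow> nat \<Rightarrow> ('d list \<Rightarrow> 'k) \<Rightarrow> bool" where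
  "diff_form E p \<omega> \<longleftrightarrow>
     (\<forall>xs i x y. length xs = p \<and> i < p \<longrightarrow> \<omega> (xs[i := x + y]) = \<omega> (xs[i := x]) + \<omega> (xs[i := y])) \<and>
     (\<forall>xs i a x. length xs = p \<and> i < p \<longrightarrow> \<omega> (xs[i := scl E a x]) = a * \<omega> (xs[i := x])) \<and>
     (\<forall>xs i j. length xs = p \<and> i < j \<and> j < p \<and> xs ! i = xs ! j \<longrightarrow> \<omega> xs = 0)"

definition delete_nth :: "nat \<Rightarrow> 'a list \<Rightarrow> 'a list" where
  "delete_nth i xs = take i xs @ drop (Suc i) xs"

definition de_rham ::
  "('k::field_char_0, 'd::ab_group_add) derivation_space \<Rightarrow> ('d list \<Rightarrow> 'k) \<Rightarrow> 'd list \<Rightarrow> 'k" where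
  "de_rham E \<omega> xs =
     (\<Sum>i<length xs. (-1) ^ i * der E (xs ! i) (\<omega> (delete_nth i xs)))
   + (\<Sum>j<length xs. \<Sum>i<j. (-1) ^ (i + j) * \<omega> (brk E (xs ! i) (xs ! j) # delete_nth i (delete_nth j xs)))"

text \<open>
  The value of the \<open>K\<close>-multilinear extension of \<open>\<omega>\<close> at \<open>K \<otimes>\<^sub>k D\<^sub>k\<close>-elements represented by the formal
  sums \<open>xs\<close>: it sends the pure tensors \<open>b\<^sub>1 \<otimes> \<eta>\<^sub>1, \<dots>, b\<^sub>p \<otimes> \<eta>\<^sub>p\<close> to \<open>b\<^sub>1 \<cdots> b\<^sub>p \<phi> (\<omega> (\<eta>\<^sub>1, \<dots>, \<eta>\<^sub>p))\<close>.
\<close>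

definition form_extension ::
  "('k::field \<Rightarrow> 'K::field) \<Rightarrow> ('d list \<Rightarrow> 'k) \<Rightarrow> ('K \<times> 'd \<Rightarrow>\<^sub>0 int) list \<Rightarrow> 'K" where
  "form_extension \<phi> \<omega> xs =
     (\<Sum>ps\<in>listset (map Poly_Mapping.keys xs).
        (\<Prod>i<length xs. of_int (Poly_Mapping.lookup (xs ! i) (ps ! i)) * fst (ps ! i)) * \<phi> (\<omega> (map snd ps)))"

text \<open>
  The map of exterior algebras induced by \<open>\<phi>\<close> and the structure map \<open>s\<close>: it is \<open>\<phi>\<close> in degree 0,
  the dual of \<open>s\<close> in degree 1, and multiplicative for the wedge product.
\<close>

definition pullback ::
  "('k::field \<Rightarrow> 'K::field) \<Rightarrow> ('D \<Rightarrow> ('K \<times> 'd \<Rightarrow>\<^sub>0 int) set) \<Rightarrow> ('d list \<Rightarrow> 'k) \<Rightarrow> 'D list \<Rightarrow> 'K" where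
  "pullback \<phi> s \<omega> \<delta>s = form_extension \<phi> \<omega> (map (\<lambda>\<delta>. rep (s \<delta>)) \<delta>s)"


section \<open>Parameterized differential fields\<close>

text \<open>\<open>K \<otimes>\<^sub>k D\<^sub>k\<close> and its scalar multiplication.\<close>

abbreviation ext_der ::
  "('k::field_char_0, 'd::ab_group_add) derivation_space \<Rightarrow> ('k \<Rightarrow> 'K::field_char_0)
     \<Rightarrow> ('K \<times> 'd \<Rightarrow>\<^sub>0 int) set monoid" where
  "ext_der E \<phi> \<equiv> tensor UNIV \<phi> UNIV (scl E)"

abbreviation ext_scale ::
  "('k::field_char_0, 'd::ab_group_add) derivation_space \<Rightarrow> ('k \<Rightarrow> 'K::field_char_0)
     \<Rightarrow> 'K \<Rightarrow> ('K \<times> 'd \<Rightarrow>\<^sub>0 int) set \<Rightarrow> ('K \<times> 'd \<Rightarrow>\<^sub>0 int) set" where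
  "ext_scale E \<phi> \<equiv> tensor_scale UNIV \<phi> UNIV (scl E)"

locale differential_field_morphism =
  k: differential_field E + K: differential_field F
  for E :: "('k::field_char_0, 'd::ab_group_add) derivation_space"
    and F :: "('K::field_char_0, 'D::ab_group_add) derivation_space" +
  fixes \<phi> :: "'k \<Rightarrow> 'K"
    and s :: "'D \<Rightarrow> ('K \<times> 'd \<Rightarrow>\<^sub>0 int) set"
  assumes hom_one: "\<phi> 1 = 1"
    and hom_add: "\<phi> (a + b) = \<phi> a + \<phi> b"
    and hom_mult: "\<phi> (a * b) = \<phi> a * \<phi> b"
    and str_closed: "s \<delta> \<in> carrier (ext_der E \<phi>)"
    and str_add: "s (\<delta> + \<epsilon>) = s \<delta> \<otimes>\<^bsub>ext_der E \<phi>\<^esub> s \<epsilon>"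
    and str_scl: "s (scl F c \<delta>) = ext_scale E \<phi> c (s \<delta>)"
    and str_der: "x \<in> s \<delta> \<Longrightarrow>
      der F \<delta> (\<phi> a) = (\<Sum>(b, \<eta>)\<in>Poly_Mapping.keys x.
                          of_int (Poly_Mapping.lookup x (b, \<eta>)) * (b * \<phi> (der E \<eta> a)))"
    and str_de_rham: "\<lbrakk>diff_form E p \<omega>; length \<delta>s = Suc p\<rbrakk> \<Longrightarrow>
      pullback \<phi> s (de_rham E \<omega>) \<delta>s = de_rham F (pullback \<phi> s \<omega>) \<delta>s"

text \<open>\<open>D\<^bsub>K/k\<^esub>\<close>, and the preimage \<open>D\<^bsub>K,\<eta>\<^esub>\<close> of \<open>K \<otimes> \<eta>\<close>.\<close>

definition relative_der ::
  "('k::field_char_0, 'd::ab_group_add) derivation_space \<Rightarrow> ('k \<Rightarrow> 'K::field_char_0)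
     \<Rightarrow> ('D \<Rightarrow> ('K \<times> 'd \<Rightarrow>\<^sub>0 int) set) \<Rightarrow> 'D set" where
  "relative_der E \<phi> s = {\<delta>. s \<delta> = \<one>\<^bsub>ext_der E \<phi>\<^esub>}"

definition der_over ::
  "('k::field_char_0, 'd::ab_group_add) derivation_space \<Rightarrow> ('k \<Rightarrow> 'K::field_char_0)
     \<Rightarrow> ('D \<Rightarrow> ('K \<times> 'd \<Rightarrow>\<^sub>0 int) set) \<Rightarrow> 'd \<Rightarrow> 'D set" where
  "der_over E \<phi> s \<eta> = {\<delta>. \<exists>c. s \<delta> = tensor_class UNIV \<phi> UNIV (scl E) (frag_of (c, \<eta>))}"

locale parameterized_differential_field = differential_field_morphism E F \<phi> s
  for E :: "('k::field_char_0, 'd::ab_group_add) derivation_space"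
    and F :: "('K::field_char_0, 'D::ab_group_add) derivation_space"
    and \<phi> :: "'k \<Rightarrow> 'K"
    and s :: "'D \<Rightarrow> ('K \<times> 'd \<Rightarrow>\<^sub>0 int) set" +
  assumes str_surj: "range s = carrier (ext_der E \<phi>)"
    and relative_constants: "constants F (relative_der E \<phi> s) = range \<phi>"

definition extends_action ::
  "('K::field_char_0, 'D::ab_group_add) derivation_space \<Rightarrow> 'D set \<Rightarrow> 'D set
     \<Rightarrow> ('K \<Rightarrow> 'n::ab_group_add \<Rightarrow> 'n) \<Rightarrow> 'n set \<Rightarrow> ('D \<Rightarrow> 'n \<Rightarrow> 'n) \<Rightarrow> bool" where
  "extends_action F D D' sc N act \<longleftrightarrow>
     (\<exists>act'. differential_module F D' sc N act' \<and> (\<forall>\<delta>\<in>D. \<forall>n\<in>N. act' \<delta> n = act \<delta> n))"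

definition isomonodromic ::
  "('k::field_char_0, 'd::ab_group_add) derivation_space
     \<Rightarrow> ('K::field_char_0, 'D::ab_group_add) derivation_space
     \<Rightarrow> ('k \<Rightarrow> 'K) \<Rightarrow> ('D \<Rightarrow> ('K \<times> 'd \<Rightarrow>\<^sub>0 int) set)
     \<Rightarrow> ('K \<Rightarrow> 'n::ab_group_add \<Rightarrow> 'n) \<Rightarrow> 'n set \<Rightarrow> ('D \<Rightarrow> 'n \<Rightarrow> 'n) \<Rightarrow> bool" where
  "isomonodromic E F \<phi> s sc N act \<longleftrightarrow>
     extends_action F (relative_der E \<phi> s) UNIV sc N act"

definition isomonodromic_along ::
  "('k::field_char_0, 'd::ab_group_add) derivation_space
     \<Rightarrow> ('K::field_char_0, 'D::ab_group_add) derivation_space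
     \<Rightarrow> ('k \<Rightarrow> 'K) \<Rightarrow> ('D \<Rightarrow> ('K \<times> 'd \<Rightarrow>\<^sub>0 int) set) \<Rightarrow> 'd
     \<Rightarrow> ('K \<Rightarrow> 'n::ab_group_add \<Rightarrow> 'n) \<Rightarrow> 'n set \<Rightarrow> ('D \<Rightarrow> 'n \<Rightarrow> 'n) \<Rightarrow> bool" where
  "isomonodromic_along E F \<phi> s \<eta> sc N act \<longleftrightarrow>
     extends_action F (relative_der E \<phi> s) (der_over E \<phi> s \<eta>) sc N act"

end

theory Submission
  imports Defs "HOL-Library.Product_Plus"
begin

text \<open>
  Let \<open>nab\<close> be a connection on \<open>N\<close> along the part of \<open>D\<^sub>K\<close> over \<open>D\<^sub>i\<close>, extending the given action of
  \<open>D\<^bsub>K/k\<^esub>\<close>. Consider the pairs \<open>(x, T)\<close> of a lift \<open>x\<close> to \<open>D\<^sub>K\<close> of an element of \<open>D\<^sub>i\<^sub>+\<^sub>1\<close> and an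
  operator \<open>T\<close> on \<open>N\<close> over \<open>x\<close> that is flat against \<open>D\<^bsub>K/k\<^esub>\<close>. They form a Lie algebra; isomonodromicity
  along a basis makes its projection to \<open>D\<^sub>i\<^sub>+\<^sub>1\<close> surjective. Modulo the subalgebra of the pairs
  \<open>(y, nab y)\<close> it is a \<open>k\<close>-space on which \<open>D\<^sub>i\<close> acts by the adjoint action, and it is an extension of
  \<open>D\<^sub>i\<^sub>+\<^sub>1 / D\<^sub>i\<close> by the horizontal endomorphisms of \<open>N\<close>, hence finite-dimensional because the constants
  of \<open>D\<^bsub>K/k\<^esub>\<close> are \<open>k\<close>. As \<open>k\<close> is linearly \<open>D\<^sub>i\<close>-closed, horizontal vectors span it, and one of them has
  nonzero image in \<open>D\<^sub>i\<^sub>+\<^sub>1 / D\<^sub>i\<close>: its operator \<open>T\<close> extends \<open>nab\<close> flatly to the part of \<open>D\<^sub>K\<close> over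
  \<open>D\<^sub>i\<^sub>+\<^sub>1\<close>.
\<close>

section \<open>Semilinear maps on an extension of scalars\<close>

text \<open>The linear extension of \<open>g\<close> to the tensor product, evaluated on a formal
  sum that represents a tensor. The sum in \<open>str_der\<close> has this shape.\<close>

definition frag_eval :: "('v \<Rightarrow> 'a::comm_ring_1) \<Rightarrow> ('a \<times> 'v \<Rightarrow>\<^sub>0 int) \<Rightarrow> 'a" where
  "frag_eval g x = (\<Sum>(b, v)\<in>Poly_Mapping.keys x. of_int (Poly_Mapping.lookup x (b, v)) * (b * g v))"

lemma frag_eval_superset:
  assumes "finite S" "Poly_Mapping.keys x \<subseteq> S"
  shows "frag_eval g x = (\<Sum>(b, v)\<in>S. of_int (Poly_Mapping.lookup x (b, v)) * (b * g v))"
  unfolding frag_eval_def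
  by (rule sum.mono_neutral_left) (use assms in \<open>auto simp: in_keys_iff\<close>)

lemma frag_eval_0 [simp]: "frag_eval g 0 = 0"
  by (simp add: frag_eval_def)

lemma frag_eval_of [simp]: "frag_eval g (frag_of (b, v)) = b * g v"
  by (simp add: frag_eval_def)

lemma frag_eval_diff: "frag_eval g (x - y) = frag_eval g x - frag_eval g y"
proof -
  let ?S = "Poly_Mapping.keys x \<union> Poly_Mapping.keys y"
  have "Poly_Mapping.keys (x - y) \<subseteq> ?S"
    by (auto simp: in_keys_iff lookup_minus)
  then show ?thesis
    by (simp add: frag_eval_superset[of ?S] lookup_minus sum_subtractf[symmetric]
        split_beta algebra_simps)
qed

lemma frag_eval_add: "frag_eval g (x + y) = frag_eval g x + frag_eval g y"
  using frag_eval_diff[of g "x + y" y] by simp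

lemma frag_eval_minus: "frag_eval g (- x) = - frag_eval g x"
  using frag_eval_diff[of g 0 x] by simp

lemma frag_eval_sum: "frag_eval g (sum f A) = (\<Sum>i\<in>A. frag_eval g (f i))"
  by (induction A rule: infinite_finite_induct) (auto simp: frag_eval_add)

lemma frag_eval_extend_scale:
  "frag_eval g (frag_extend (\<lambda>(b, v). frag_of (c * b, v)) x) = c * frag_eval g x"
proof (induction x rule: frag_induction[OF subset_UNIV])
  case (3 a b)
  then show ?case
    by (simp add: frag_extend_diff frag_eval_diff algebra_simps)
qed (auto simp: algebra_simps)

text \<open>With \<open>\<phi>\<close> = \<open>id\<close> these are ordinary linear forms; for a
  field embedding \<open>\<phi>\<close> they are the maps that extend linearly to the tensor
  product.\<close>

definition semilinear :: "('r \<Rightarrow> 'a) \<Rightarrow> ('r \<Rightarrow> 'v \<Rightarrow> 'v) \<Rightarrow> ('v::ab_group_add \<Rightarrow> 'a::comm_ring_1) \<Rightarrow> bool" where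
  "semilinear \<phi> sc g \<longleftrightarrow> (\<forall>v w. g (v + w) = g v + g w) \<and> (\<forall>r v. g (sc r v) = \<phi> r * g v)"

section \<open>Congruence modulo the tensor relations\<close>

abbreviation full_kernel where
  "full_kernel \<phi> sc \<equiv> tensor_kernel UNIV \<phi> UNIV sc"

lemma full_kernel_zero: "0 \<in> full_kernel \<phi> sc"
  using generate.one[of "free_Abelian_group (UNIV \<times> UNIV)"] by (simp add: tensor_kernel_def)

lemma full_kernel_add: "x \<in> full_kernel \<phi> sc \<Longrightarrow> y \<in> full_kernel \<phi> sc \<Longrightarrow> x + y \<in> full_kernel \<phi> sc"
  using generate.eng[of _ "free_Abelian_group (UNIV \<times> UNIV)"] by (fastforce simp: tensor_kernel_def)

lemma full_kernel_minus: "x \<in> full_kernel \<phi> sc \<Longrightarrow> - x \<in> full_kernel \<phi> sc"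
  using group.generate_m_inv_closed[OF group_free_Abelian_group, of _ "UNIV \<times> UNIV"]
  by (fastforce simp: tensor_kernel_def)

lemma full_kernel_diff: "x \<in> full_kernel \<phi> sc \<Longrightarrow> y \<in> full_kernel \<phi> sc \<Longrightarrow> x - y \<in> full_kernel \<phi> sc"
  using full_kernel_add[OF _ full_kernel_minus, of x \<phi> sc y] by simp

lemma full_kernel_sum: "(\<And>i. i \<in> A \<Longrightarrow> f i \<in> full_kernel \<phi> sc) \<Longrightarrow> sum f A \<in> full_kernel \<phi> sc"
  by (induction A rule: infinite_finite_induct) (auto simp: full_kernel_zero full_kernel_add)

lemma tensor_relation_in_kernel: "x \<in> tensor_relations UNIV \<phi> UNIV sc \<Longrightarrow> x \<in> full_kernel \<phi> sc"
  by (simp add: tensor_kernel_def generate.incl)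

lemma frag_of_add_left: "frag_of (a + b, v) - frag_of (a, v) - frag_of (b, v) \<in> full_kernel \<phi> sc"
  by (rule tensor_relation_in_kernel) (unfold tensor_relations_def, blast)

lemma frag_of_add_right: "frag_of (a, v + w) - frag_of (a, v) - frag_of (a, w) \<in> full_kernel \<phi> sc"
  by (rule tensor_relation_in_kernel) (unfold tensor_relations_def, blast)

lemma frag_of_scale: "frag_of (a * \<phi> r, v) - frag_of (a, sc r v) \<in> full_kernel \<phi> sc"
  by (rule tensor_relation_in_kernel) (unfold tensor_relations_def, blast)

lemma frag_of_zero_left: "frag_of (0, v) \<in> full_kernel \<phi> sc"
  using full_kernel_minus[OF frag_of_add_left[of 0 0 v \<phi> sc]] by simp

lemma frag_of_zero_right: "frag_of (a, 0) \<in> full_kernel \<phi> sc"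
  using full_kernel_minus[OF frag_of_add_right[of a 0 0 \<phi> sc]] by simp

lemma frag_of_sum_right:
  "finite A \<Longrightarrow> frag_of (a, sum f A) - (\<Sum>i\<in>A. frag_of (a, f i)) \<in> full_kernel \<phi> sc"
proof (induction A rule: finite_induct)
  case (insert i A)
  from full_kernel_add[OF insert.IH frag_of_add_right[of a "f i" "sum f A" \<phi> sc]] insert(1,2)
  show ?case by (simp add: algebra_simps)
qed (simp add: frag_of_zero_right)

text \<open>Each defining relation evaluates to zero, by distributivity or by semilinearity, and
  vanishing passes to the generated subgroup.\<close>

lemma frag_eval_kernel:
  assumes "semilinear \<phi> sc g" and "x \<in> full_kernel \<phi> sc"
  shows "frag_eval g x = 0"
proof -
  have rel: "frag_eval g y = 0" if "y \<in> tensor_relations UNIV \<phi> UNIV sc" for y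
    using that assms(1) unfolding tensor_relations_def semilinear_def
    by (elim UnE CollectE exE conjE; hypsubst) (simp_all add: frag_eval_diff distrib_left distrib_right)
  from assms(2) show ?thesis unfolding tensor_kernel_def
    by (induction x rule: generate.induct) (auto simp: rel frag_eval_add frag_eval_minus)
qed

text \<open>The free group is abelian, so cosets are translates; equality of tensors becomes a
  congruence of formal sums.\<close>

lemma tensor_class_full: "tensor_class UNIV \<phi> UNIV sc x = {y. y - x \<in> full_kernel \<phi> sc}"
  unfolding tensor_class_def r_coset_def
  by (force simp: algebra_simps)

lemma mem_tensor_class: "x \<in> tensor_class UNIV \<phi> UNIV sc x"
  by (simp add: tensor_class_full full_kernel_zero)

lemma tensor_class_eq_iff:
  "tensor_class UNIV \<phi> UNIV sc x = tensor_class UNIV \<phi> UNIV sc y \<longleftrightarrow> x - y \<in> full_kernel \<phi> sc"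
proof
  assume "tensor_class UNIV \<phi> UNIV sc x = tensor_class UNIV \<phi> UNIV sc y"
  then show "x - y \<in> full_kernel \<phi> sc"
    using mem_tensor_class[of x \<phi> sc] by (simp add: tensor_class_full)
next
  assume *: "x - y \<in> full_kernel \<phi> sc"
  have "z - x \<in> full_kernel \<phi> sc \<longleftrightarrow> z - y \<in> full_kernel \<phi> sc" for z
    using full_kernel_add[OF _ *, of "z - x"] full_kernel_diff[OF _ *, of "z - y"] by auto
  then show "tensor_class UNIV \<phi> UNIV sc x = tensor_class UNIV \<phi> UNIV sc y"
    by (simp add: tensor_class_full)
qed

lemma carrier_tensor_full:
  "carrier (tensor UNIV \<phi> UNIV sc) = range (tensor_class UNIV \<phi> UNIV sc)"
  by (auto simp: tensor_def FactGroup_def RCOSETS_def tensor_class_def)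

lemma one_tensor_full: "\<one>\<^bsub>tensor UNIV \<phi> UNIV sc\<^esub> = tensor_class UNIV \<phi> UNIV sc 0"
  by (simp add: tensor_def FactGroup_def tensor_class_full)

lemma rep_class:
  assumes "t \<in> carrier (tensor UNIV \<phi> UNIV sc)"
  shows "tensor_class UNIV \<phi> UNIV sc (rep t) = t"
proof -
  obtain x where x: "t = tensor_class UNIV \<phi> UNIV sc x"
    using assms by (auto simp: carrier_tensor_full)
  have "rep t \<in> t"
    unfolding rep_def by (rule someI[of _ x]) (simp add: x mem_tensor_class)
  then show ?thesis
    unfolding x tensor_class_eq_iff by (simp add: tensor_class_full)
qed

lemma rep_tensor_class_diff:
  "rep (tensor_class UNIV \<phi> UNIV sc x) - x \<in> full_kernel \<phi> sc"
  using rep_class[of "tensor_class UNIV \<phi> UNIV sc x" \<phi> sc]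
  unfolding carrier_tensor_full tensor_class_eq_iff by blast

lemma mult_tensor_class:
  "tensor_class UNIV \<phi> UNIV sc x \<otimes>\<^bsub>tensor UNIV \<phi> UNIV sc\<^esub> tensor_class UNIV \<phi> UNIV sc y
    = tensor_class UNIV \<phi> UNIV sc (x + y)"
proof -
  have "(\<exists>a. a - x \<in> full_kernel \<phi> sc \<and> (\<exists>b. b - y \<in> full_kernel \<phi> sc \<and> z = a + b))
      \<longleftrightarrow> z - (x + y) \<in> full_kernel \<phi> sc" for z
  proof safe
    fix a b assume "a - x \<in> full_kernel \<phi> sc" "b - y \<in> full_kernel \<phi> sc"
    from full_kernel_add[OF this] show "a + b - (x + y) \<in> full_kernel \<phi> sc"
      by (simp add: algebra_simps)
  next
    assume "z - (x + y) \<in> full_kernel \<phi> sc"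
    then show "\<exists>a. a - x \<in> full_kernel \<phi> sc \<and> (\<exists>b. b - y \<in> full_kernel \<phi> sc \<and> z = a + b)"
      by (intro exI[of _ "z - y"] exI[of _ y] conjI) (auto simp: full_kernel_zero algebra_simps)
  qed
  then show ?thesis
    by (auto simp: tensor_def FactGroup_def set_mult_def tensor_class_full)
qed

text \<open>Closure of \<open>V\<close> puts the relations, hence the kernel and its cosets, inside
  the free group on \<open>UNIV \<times> V\<close>. This controls the support over which
  \<open>natural_map\<close> sums.\<close>

lemma keys_rep_tensor:
  assumes add: "\<And>v w. v \<in> V \<Longrightarrow> w \<in> V \<Longrightarrow> v + w \<in> V"
    and scale: "\<And>r v. r \<in> R \<Longrightarrow> v \<in> V \<Longrightarrow> sc r v \<in> V"
    and t: "t \<in> carrier (tensor R \<phi> V sc)"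
  shows "Poly_Mapping.keys (rep t) \<subseteq> UNIV \<times> V"
proof -
  let ?G = "free_Abelian_group (UNIV \<times> V)"
  interpret G: group ?G by simp
  have diff: "Poly_Mapping.keys (x - y) \<subseteq> UNIV \<times> V"
    if "Poly_Mapping.keys x \<subseteq> UNIV \<times> V" "Poly_Mapping.keys y \<subseteq> UNIV \<times> V" for x y :: "_ \<Rightarrow>\<^sub>0 int"
    using that keys_diff[of x y] by blast
  have "tensor_relations R \<phi> V sc \<subseteq> carrier ?G"
    unfolding tensor_relations_def carrier_free_Abelian_group_iff[symmetric]
    by (intro Un_least subsetI; elim CollectE exE conjE; hypsubst)
      (simp_all add: add scale diff)
  then have K: "subgroup (tensor_kernel R \<phi> V sc) ?G"
    unfolding tensor_kernel_def by (rule G.generate_is_subgroup)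
  from t obtain x where x: "x \<in> carrier ?G" "t = tensor_kernel R \<phi> V sc #>\<^bsub>?G\<^esub> x"
    by (auto simp: tensor_def FactGroup_def RCOSETS_def)
  have "x \<in> t"
    using G.rcos_self[OF x(1) K] x(2) by simp
  then have "rep t \<in> t"
    unfolding rep_def by (rule someI)
  then have "rep t \<in> carrier ?G"
    using G.r_coset_subset_G[OF subgroup.subset[OF K] x(1)] x(2) by blast
  then show ?thesis by simp
qed

section \<open>Lifts of derivations\<close>

context differential_field
begin

sublocale vs: vector_space "scl E"
  by (rule vector_space)

lemma brk_zero [simp]: "brk E 0 \<delta> = 0" "brk E \<delta> 0 = 0"
  using brk_add_left[of 0 0 \<delta>] brk_add_right[of \<delta> 0 0] by simp_all

lemma brk_anti: "brk E \<eta> \<delta> = - brk E \<delta> \<eta>"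
proof -
  have "brk E (\<eta> + \<delta>) (\<eta> + \<delta>) = brk E \<eta> \<delta> + brk E \<delta> \<eta>"
    unfolding brk_add_left brk_add_right by (simp add: brk_self)
  then show ?thesis
    unfolding brk_self by (simp add: eq_neg_iff_add_eq_0)
qed

lemma brk_minus_right [simp]: "brk E \<delta> (- \<eta>) = - brk E \<delta> \<eta>"
  using brk_add_right[of \<delta> \<eta> "- \<eta>"] by (simp add: eq_neg_iff_add_eq_0 add.commute)

lemma brk_scl_left: "brk E (scl E a \<eta>) \<delta> = scl E a (brk E \<eta> \<delta>) - scl E (der E \<delta> a) \<eta>"
  by (simp add: brk_anti[of _ \<delta>] brk_scl vs.scale_minus_right)

lemma jacobi': "brk E \<eta> (brk E \<delta> \<epsilon>) = brk E (brk E \<eta> \<delta>) \<epsilon> + brk E \<delta> (brk E \<eta> \<epsilon>)"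
proof -
  have "brk E \<epsilon> (brk E \<eta> \<delta>) = - brk E (brk E \<eta> \<delta>) \<epsilon>" "brk E \<delta> (brk E \<epsilon> \<eta>) = - brk E \<delta> (brk E \<eta> \<epsilon>)"
    by (rule brk_anti) (simp add: brk_anti[of \<epsilon> \<eta>])
  then show ?thesis
    using jacobi[of \<eta> \<delta> \<epsilon>] by (simp add: algebra_simps)
qed

lemma der_zero [simp]: "der E 0 a = 0"
  using der_add[of 0 0 a] by simp

lemma finite_basis: obtains B where "finite B" "vs.independent B" "vs.span B = UNIV"
proof -
  obtain C where C: "finite C" "UNIV \<subseteq> vs.span C"
    using finite_dim by (auto simp: finite_dim_def)
  obtain B where "B \<subseteq> C" "vs.independent B" "C \<subseteq> vs.span B"
    using vs.maximal_independent_subset[of C] by blast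
  then show thesis
    using C that[of B] vs.span_mono[of C "vs.span B"] finite_subset[of B C]
    by (simp add: vs.span_span top.extremum_uniqueI)
qed

end

context differential_field_morphism
begin

lemma hom_zero [simp]: "\<phi> 0 = 0"
  using hom_add[of 0 0] by simp

lemma hom_minus [simp]: "\<phi> (- a) = - \<phi> a"
  using hom_add[of a "- a"] by (simp add: eq_neg_iff_add_eq_0 add.commute)

lemma hom_diff: "\<phi> (a - b) = \<phi> a - \<phi> b"
  using hom_add[of a "- b"] by simp

lemma hom_eq_zero_iff [simp]: "\<phi> a = 0 \<longleftrightarrow> a = 0"
proof
  assume "\<phi> a = 0"
  then show "a = 0"
    using hom_mult[of a "inverse a"] hom_one by (cases "a = 0") auto
qed simp

lemma hom_inverse: "\<phi> (inverse a) = inverse (\<phi> a)"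
proof (cases "a = 0")
  case False
  then have "\<phi> a * \<phi> (inverse a) = 1"
    by (simp add: hom_mult[symmetric] hom_one)
  then show ?thesis
    by (metis inverse_unique)
qed simp

text \<open>The \<open>K\<close>-linear form on \<open>D\<^sub>K\<close> induced by a semilinear form \<open>g\<close> on \<open>D\<^sub>k\<close>.\<close>

definition pull :: "('d \<Rightarrow> 'K) \<Rightarrow> 'D \<Rightarrow> 'K" where
  "pull g \<delta> = frag_eval g (rep (s \<delta>))"

text \<open>Lifts of pure tensors with coefficient 1 are preferred to general elements of
  \<open>D\<^sub>K\<close>: derivations and brackets are compatible on them without derivatives of
  coefficients.\<close>

definition lifts :: "'D \<Rightarrow> 'd \<Rightarrow> bool" where
  "lifts \<delta> \<eta> \<longleftrightarrow> s \<delta> = tensor_class UNIV \<phi> UNIV (scl E) (frag_of (1, \<eta>))"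

lemma class_rep: "tensor_class UNIV \<phi> UNIV (scl E) (rep (s \<delta>)) = s \<delta>"
  by (rule rep_class) (rule str_closed)

text \<open>Evaluation vanishes on the kernel, so any representative may replace the one chosen in
  \<open>pull\<close>.\<close>

lemma pull_class:
  assumes "semilinear \<phi> (scl E) g" "s \<delta> = tensor_class UNIV \<phi> UNIV (scl E) x"
  shows "pull g \<delta> = frag_eval g x"
  using frag_eval_kernel[OF assms(1) rep_tensor_class_diff[of \<phi> "scl E" x]] assms(2)
  by (simp add: pull_def frag_eval_diff)

lemma pull_lift:
  assumes "semilinear \<phi> (scl E) g" "lifts \<delta> \<eta>"
  shows "pull g \<delta> = g \<eta>"
  using pull_class[OF assms(1), of \<delta> "frag_of (1, \<eta>)"] assms(2) by (simp add: lifts_def)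

lemma pull_add:
  assumes "semilinear \<phi> (scl E) g"
  shows "pull g (\<delta> + \<epsilon>) = pull g \<delta> + pull g \<epsilon>"
proof -
  have "s (\<delta> + \<epsilon>) = tensor_class UNIV \<phi> UNIV (scl E) (rep (s \<delta>) + rep (s \<epsilon>))"
    by (simp add: str_add mult_tensor_class[symmetric] class_rep)
  from pull_class[OF assms this] show ?thesis
    by (simp add: frag_eval_add pull_def)
qed

lemma pull_scl:
  assumes "semilinear \<phi> (scl E) g"
  shows "pull g (scl F c \<delta>) = c * pull g \<delta>"
  using pull_class[OF assms str_scl[unfolded tensor_scale_def]]
  by (simp add: frag_eval_extend_scale pull_def)

lemma pull_zero: "semilinear \<phi> (scl E) g \<Longrightarrow> pull g 0 = 0"
  using pull_add[of g 0 0] by simp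

lemma pull_diff: "semilinear \<phi> (scl E) g \<Longrightarrow> pull g (\<delta> - \<epsilon>) = pull g \<delta> - pull g \<epsilon>"
  using pull_add[of g "\<delta> - \<epsilon>" \<epsilon>] by simp

lemma semilinear_hom:
  assumes "semilinear id (scl E) l"
  shows "semilinear \<phi> (scl E) (\<lambda>\<eta>. \<phi> (l \<eta>))"
  using assms by (simp add: semilinear_def hom_add hom_mult)

lemma semilinear_representation:
  assumes "k.vs.independent B" "k.vs.span B = UNIV"
  shows "semilinear id (scl E) (\<lambda>\<eta>. k.vs.representation B \<eta> e)"
  using assms by (simp add: semilinear_def k.vs.representation_add k.vs.representation_scale)

text \<open>On a generator, expand the second factor in the basis and move the scalars to the left;
  the general case is additive. Thus a tensor is determined by its coordinates.\<close>

lemma frag_basis_expansion: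
  assumes B: "finite B" "k.vs.independent B" "k.vs.span B = UNIV"
  shows "x - (\<Sum>e\<in>B. frag_of (frag_eval (\<lambda>\<eta>. \<phi> (k.vs.representation B \<eta> e)) x, e))
    \<in> full_kernel \<phi> (scl E)"
proof (induction x rule: frag_induction[OF subset_UNIV])
  case 1
  have "- (\<Sum>e\<in>B. frag_of (0, e)) \<in> full_kernel \<phi> (scl E)"
    by (intro full_kernel_minus full_kernel_sum frag_of_zero_left)
  then show ?case by simp
next
  case (2 x)
  obtain b v where x: "x = (b, v)" by (cases x)
  let ?r = "k.vs.representation B v"
  have v: "(\<Sum>e\<in>B. scl E (?r e) e) = v"
    by (rule k.vs.sum_representation_eq) (use B in auto)
  have "frag_of (b, v) - (\<Sum>e\<in>B. frag_of (b, scl E (?r e) e)) \<in> full_kernel \<phi> (scl E)"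
    using frag_of_sum_right[OF B(1), of b "\<lambda>e. scl E (?r e) e" \<phi> "scl E"] by (simp add: v)
  from full_kernel_diff[OF this full_kernel_sum[of B
        "\<lambda>e. frag_of (b * \<phi> (?r e), e) - frag_of (b, scl E (?r e) e)" \<phi> "scl E", OF frag_of_scale]]
  show ?case by (simp add: x sum_subtractf)
next
  case (3 x y)
  have "frag_of (a - b, e) - (frag_of (a, e) - frag_of (b, e)) \<in> full_kernel \<phi> (scl E)" for a b e
    using full_kernel_minus[OF frag_of_add_left[of "a - b" b e \<phi> "scl E"]] by (simp add: algebra_simps)
  note step = this
  let ?c = "\<lambda>z e. frag_eval (\<lambda>\<eta>. \<phi> (k.vs.representation B \<eta> e)) z"
  have "(\<Sum>e\<in>B. frag_of (?c x e - ?c y e, e) - (frag_of (?c x e, e) - frag_of (?c y e, e)))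
      \<in> full_kernel \<phi> (scl E)"
    by (rule full_kernel_sum) (rule step)
  from full_kernel_diff[OF full_kernel_diff[OF 3] this]
  show ?case by (simp add: sum_subtractf sum.distrib frag_eval_diff algebra_simps)
qed

text \<open>Linear forms separate tensors, since the coordinate forms of a basis already do. Closure
  properties of lifts thereby reduce to computations with \<open>pull\<close>.\<close>

lemma lifts_iff:
  "lifts \<delta> \<eta> \<longleftrightarrow> (\<forall>l. semilinear id (scl E) l \<longrightarrow> pull (\<lambda>\<eta>. \<phi> (l \<eta>)) \<delta> = \<phi> (l \<eta>))"
proof
  assume R: "\<forall>l. semilinear id (scl E) l \<longrightarrow> pull (\<lambda>\<eta>. \<phi> (l \<eta>)) \<delta> = \<phi> (l \<eta>)"
  obtain B where B: "finite B" "k.vs.independent B" "k.vs.span B = UNIV"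
    by (rule k.finite_basis)
  have "rep (s \<delta>) - frag_of (1, \<eta>) \<in> full_kernel \<phi> (scl E)"
    using full_kernel_diff[OF frag_basis_expansion[OF B, of "rep (s \<delta>)"]
        frag_basis_expansion[OF B, of "frag_of (1, \<eta>)"]]
      R[rule_format, OF semilinear_representation[OF B(2,3)]]
    by (simp add: pull_def)
  then show "lifts \<delta> \<eta>"
    using class_rep tensor_class_eq_iff lifts_def by metis
qed (auto simp: pull_lift semilinear_hom)

lemma lifts_add: "lifts \<delta> \<eta> \<Longrightarrow> lifts \<epsilon> \<zeta> \<Longrightarrow> lifts (\<delta> + \<epsilon>) (\<eta> + \<zeta>)"
  by (auto simp: lifts_iff pull_add semilinear_hom) (auto simp: semilinear_def hom_add)

lemma lifts_scl: "lifts \<delta> \<eta> \<Longrightarrow> lifts (scl F (\<phi> a) \<delta>) (scl E a \<eta>)"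
  by (auto simp: lifts_iff pull_scl semilinear_hom) (auto simp: semilinear_def hom_mult)

lemma lifts_zero: "lifts 0 0"
  by (auto simp: lifts_iff pull_zero semilinear_hom) (metis add_cancel_left_left semilinear_def)

lemma lifts_diff: "lifts \<delta> \<eta> \<Longrightarrow> lifts \<epsilon> \<zeta> \<Longrightarrow> lifts (\<delta> - \<epsilon>) (\<eta> - \<zeta>)"
  using lifts_add[of \<delta> \<eta> "scl F (\<phi> (-1)) \<epsilon>" "scl E (-1) \<zeta>"] lifts_scl[of \<epsilon> \<zeta> "-1"]
  by (simp add: hom_one)

lemma relative_der_iff: "\<delta> \<in> relative_der E \<phi> s \<longleftrightarrow> lifts \<delta> 0"
proof -
  have "tensor_class UNIV \<phi> UNIV (scl E) 0 = tensor_class UNIV \<phi> UNIV (scl E) (frag_of (1, 0))"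
    by (simp add: tensor_class_eq_iff full_kernel_minus frag_of_zero_right)
  then show ?thesis
    by (simp add: relative_der_def lifts_def one_tensor_full)
qed

lemma relative_der_iff_pull:
  "\<delta> \<in> relative_der E \<phi> s \<longleftrightarrow> (\<forall>l. semilinear id (scl E) l \<longrightarrow> pull (\<lambda>\<eta>. \<phi> (l \<eta>)) \<delta> = 0)"
  unfolding relative_der_iff lifts_iff
  by (metis add_cancel_left_left hom_zero semilinear_def)

lemma subspace_relative_der: "K.vs.subspace (relative_der E \<phi> s)"
  by (auto simp: K.vs.subspace_def relative_der_iff_pull pull_zero pull_add pull_scl semilinear_hom)

lemma lifts_der:
  assumes "lifts \<delta> \<eta>"
  shows "der F \<delta> (\<phi> a) = \<phi> (der E \<eta> a)"
proof -
  have "frag_of (1, \<eta>) \<in> s \<delta>"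
    using assms mem_tensor_class[of "frag_of (1, \<eta>)" \<phi> "scl E"] by (simp add: lifts_def)
  from str_der[OF this, of a] show ?thesis by simp
qed

section \<open>Pullback of forms of degree one and two, and brackets of lifts\<close>

lemma sum_listset_two:
  "(\<Sum>ps\<in>listset [A, B]. f ps) = (\<Sum>p\<in>A. \<Sum>q\<in>B. f [p, q])"
proof -
  have "listset [A, B] = (\<lambda>(p, q). [p, q]) ` (A \<times> B)"
    by (auto simp: set_Cons_def)
  then show ?thesis
    by (simp add: sum.reindex inj_on_def sum.cartesian_product split_beta)
qed

lemma sum_listset_one: "(\<Sum>ps\<in>listset [A]. f ps) = (\<Sum>p\<in>A. f [p])"
proof -
  have "listset [A] = (\<lambda>p. [p]) ` A"
    by (auto simp: set_Cons_def)
  then show ?thesis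
    by (simp add: sum.reindex inj_on_def)
qed

lemma pullback_one: "pullback \<phi> s \<omega> [\<delta>] = pull (\<lambda>\<eta>. \<phi> (\<omega> [\<eta>])) \<delta>"
  unfolding pullback_def form_extension_def pull_def frag_eval_def list.map sum_listset_one
  by (simp add: split_beta mult.assoc)

lemma pullback_two:
  "pullback \<phi> s \<omega> [\<delta>, \<epsilon>] = pull (\<lambda>\<eta>. pull (\<lambda>\<zeta>. \<phi> (\<omega> [\<eta>, \<zeta>])) \<epsilon>) \<delta>"
  unfolding pullback_def form_extension_def pull_def frag_eval_def list.map sum_listset_two
  by (simp add: split_beta mult_ac sum_distrib_left lessThan_Suc)

text \<open>Compare the exterior derivative of a linear form before and after pullback: on lifts all
  terms without a bracket agree, so the bracket terms agree too, and linear forms separate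
  tensors.\<close>

lemma lifts_brk:
  assumes "lifts \<delta> \<eta>" "lifts \<epsilon> \<zeta>"
  shows "lifts (brk F \<delta> \<epsilon>) (brk E \<eta> \<zeta>)"
  unfolding lifts_iff
proof (intro allI impI)
  fix l assume l: "semilinear id (scl E) l"
  define \<omega> where "\<omega> = (\<lambda>xs. l (hd xs))"
  \<comment> \<open>\<open>\<beta>\<close> is the exterior derivative of \<open>l\<close>. It is
    bilinear because the terms that differentiate a coefficient cancel, so it can be evaluated on
    lifts one argument at a time.\<close>
  define \<beta> where "\<beta> \<eta> \<zeta> = der E \<eta> (l \<zeta>) - der E \<zeta> (l \<eta>) - l (brk E \<eta> \<zeta>)" for \<eta> \<zeta>
  have l': "l (x + y) = l x + l y" "l (x - y) = l x - l y" "l (scl E a x) = a * l x" for x y a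
    using l unfolding semilinear_def by (auto simp: eq_diff_eq) (metis diff_add_cancel)
  have \<omega>: "diff_form E 1 \<omega>"
    by (auto simp: diff_form_def \<omega>_def length_Suc_conv l')
  have dr: "de_rham E \<omega> [x, y] = \<beta> x y" for x y
    by (simp add: de_rham_def \<omega>_def \<beta>_def lessThan_Suc delete_nth_def numeral_2_eq_2)
  have "\<beta> x (y + z) = \<beta> x y + \<beta> x z" "\<beta> (x + y) z = \<beta> x z + \<beta> y z"
    "\<beta> x (scl E a y) = a * \<beta> x y" "\<beta> (scl E a x) y = a * \<beta> x y" for x y z a
    unfolding \<beta>_def
    by (simp_all add: k.der_add k.der_sum k.brk_add_left k.brk_add_right l' k.brk_scl
        k.brk_scl_left k.der_scl k.der_prod algebra_simps)
  then have \<beta>: "semilinear \<phi> (scl E) (\<lambda>y. \<phi> (\<beta> x y))" "semilinear \<phi> (scl E) (\<lambda>x. \<phi> (\<beta> x y))" for x y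
    by (simp_all add: semilinear_def hom_add hom_mult)
  have "pullback \<phi> s (de_rham E \<omega>) [\<delta>, \<epsilon>] = de_rham F (pullback \<phi> s \<omega>) [\<delta>, \<epsilon>]"
    by (rule str_de_rham[OF \<omega>]) simp
  moreover have "pullback \<phi> s (de_rham E \<omega>) [\<delta>, \<epsilon>] = \<phi> (\<beta> \<eta> \<zeta>)"
    by (simp add: pullback_two dr pull_lift[OF \<beta>(1) assms(2)] pull_lift[OF \<beta>(2) assms(1)])
  moreover have "pullback \<phi> s \<omega> [x] = pull (\<lambda>\<eta>. \<phi> (l \<eta>)) x" for x
    by (simp add: pullback_one \<omega>_def)
  ultimately have "\<phi> (\<beta> \<eta> \<zeta>) = der F \<delta> (\<phi> (l \<zeta>)) - der F \<epsilon> (\<phi> (l \<eta>)) - pull (\<lambda>\<eta>. \<phi> (l \<eta>)) (brk F \<delta> \<epsilon>)"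
    by (simp add: de_rham_def lessThan_Suc delete_nth_def numeral_2_eq_2
        pull_lift[OF semilinear_hom[OF l] assms(1)] pull_lift[OF semilinear_hom[OF l] assms(2)])
  then show "pull (\<lambda>\<eta>. \<phi> (l \<eta>)) (brk F \<delta> \<epsilon>) = \<phi> (l (brk E \<eta> \<zeta>))"
    by (simp add: \<beta>_def hom_diff lifts_der[OF assms(1)] lifts_der[OF assms(2)])
qed

definition lift_set :: "'d set \<Rightarrow> 'D set" where
  "lift_set D = {\<delta>. \<exists>\<eta>\<in>D. lifts \<delta> \<eta>}"

text \<open>The preimage of \<open>K \<otimes> D\<close> under the structure map, described through generators.\<close>

definition der_over_space :: "'d set \<Rightarrow> 'D set" where
  "der_over_space D = K.vs.span (lift_set D)"

end

section \<open>Consequences of the surjectivity of the structure map\<close>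

context parameterized_differential_field
begin

lemma lift_exists: "\<exists>\<delta>. lifts \<delta> \<eta>"
proof -
  have "tensor_class UNIV \<phi> UNIV (scl E) (frag_of (1, \<eta>)) \<in> range s"
    by (simp add: str_surj carrier_tensor_full)
  then show ?thesis
    by (auto simp: lifts_def)
qed

text \<open>Subtract from \<delta> the combination of lifts of a basis whose coefficients are the
  coordinates of its image. The difference lies in the kernel of the structure map, that is, it
  lifts zero.\<close>

lemma der_over_space_UNIV: "der_over_space UNIV = UNIV"
proof -
  obtain B where B: "finite B" "k.vs.independent B" "k.vs.span B = UNIV"
    by (rule k.finite_basis)
  from lift_exists obtain h where h: "\<And>e. lifts (h e) e" by metis
  have "\<delta> \<in> der_over_space UNIV" for \<delta>
  proof -
    define c where "c e = pull (\<lambda>\<eta>. \<phi> (k.vs.representation B \<eta> e)) \<delta>" for e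
    define \<epsilon> where "\<epsilon> = (\<Sum>e\<in>B. scl F (c e) (h e))"
    have "\<delta> - \<epsilon> \<in> relative_der E \<phi> s"
      unfolding relative_der_iff_pull
    proof (intro allI impI)
      fix l assume l: "semilinear id (scl E) l"
      let ?g = "\<lambda>\<eta>. \<phi> (l \<eta>)"
      note g = semilinear_hom[OF l]
      have sum: "pull ?g (sum f A) = (\<Sum>i\<in>A. pull ?g (f i))" for f and A :: "'d set"
        by (induction A rule: infinite_finite_induct) (auto simp: pull_zero[OF g] pull_add[OF g])
      have "pull ?g \<epsilon> = (\<Sum>e\<in>B. c e * \<phi> (l e))"
        by (simp add: \<epsilon>_def sum pull_scl[OF g] pull_lift[OF g h])
      also have "\<dots> = frag_eval ?g (\<Sum>e\<in>B. frag_of (c e, e))"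
        by (simp add: frag_eval_sum)
      also have "\<dots> = pull ?g \<delta>"
        using frag_eval_kernel[OF g frag_basis_expansion[OF B, of "rep (s \<delta>)"]]
        by (simp add: frag_eval_diff pull_def c_def)
      finally show "pull ?g (\<delta> - \<epsilon>) = 0"
        by (simp add: pull_diff[OF g])
    qed
    then have "\<delta> - \<epsilon> \<in> der_over_space UNIV"
      by (auto simp: der_over_space_def relative_der_iff lift_set_def intro!: K.vs.span_base)
    moreover have "\<epsilon> \<in> der_over_space UNIV"
      unfolding \<epsilon>_def der_over_space_def
      by (intro K.vs.span_sum K.vs.span_scale K.vs.span_base) (use h in \<open>auto simp: lift_set_def\<close>)
    ultimately have "\<delta> - \<epsilon> + \<epsilon> \<in> der_over_space UNIV"
      unfolding der_over_space_def by (rule K.vs.span_add)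
    then show ?thesis by simp
  qed
  then show ?thesis by blast
qed

lemma der_over_space_0: "der_over_space {0} = relative_der E \<phi> s"
  using subspace_relative_der by (simp add: der_over_space_def lift_set_def relative_der_iff[symmetric])

end

section \<open>Modules over linearly closed fields\<close>

text \<open>By surjectivity a vector is the value of the natural map on some tensor; the chosen
  representative has only horizontal second components, so the value is a combination of horizontal
  vectors.\<close>

lemma (in differential_module) trivial_imp_span_horizontal:
  assumes "trivial_module E D sc M act"
  shows "M \<subseteq> module.span sc (horizontal D M act)"
proof
  interpret vector_space sc by (rule vector_space)
  fix v assume "v \<in> M"
  then obtain t where t: "t \<in> carrier (tensor (constants E D) id (horizontal D M act) sc)"
    and v: "v = natural_map sc t"
    using assms by (auto simp: trivial_module_def bij_betw_def)
  have H: "v + w \<in> horizontal D M act" if "v \<in> horizontal D M act" "w \<in> horizontal D M act" for v w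
    using that subspace by (auto simp: horizontal_def act_add_right subspace_add)
  have "sc r v \<in> horizontal D M act" if "r \<in> constants E D" "v \<in> horizontal D M act" for r v
    using that subspace by (auto simp: horizontal_def constants_def act_leibniz subspace_scale)
  from keys_rep_tensor[OF H this t] show "v \<in> span (horizontal D M act)"
    unfolding v natural_map_def
    by (intro span_sum) (auto intro: span_scale span_base)
qed

text \<open>
  Linear closedness only speaks about modules of sequences; coordinates with respect to a basis
  extend it to modules in arbitrary spaces.
\<close>

lemma (in differential_module) linearly_closed_imp_span_horizontal:
  assumes closed: "linearly_closed E D" and fd: "finite_dim sc M" and E: "differential_field E"
  shows "M \<subseteq> module.span sc (horizontal D M act)"
proof -
  interpret vector_space sc by (rule vector_space)
  interpret E: differential_field E by (rule E)
  let ?seq = "\<lambda>(a::'k) (v::nat \<Rightarrow> 'k) i. a * v i"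
  interpret S: vector_space ?seq
    by unfold_locales (auto simp: algebra_simps fun_eq_iff)
  obtain C where C: "finite C" "C \<subseteq> M" "M \<subseteq> span C"
    using fd by (auto simp: finite_dim_def)
  obtain B where B: "B \<subseteq> C" "independent B" "C \<subseteq> span B"
    using maximal_independent_subset[of C] by blast
  have "finite B" using B(1) C(1) finite_subset by blast
  then obtain h n where h: "B = h ` {i::nat. i < n}" "inj_on h {i. i < n}"
    using finite_imp_nat_seg_image_inj_on by blast
  have "M \<subseteq> span B" using C(3) span_mono[OF B(3)] by (simp add: span_span)
  moreover have "span B \<subseteq> M" using B(1) C(2) subspace by (simp add: span_minimal)
  ultimately have M: "M = span B" by blast
  \<comment> \<open>\<open>\<Theta>\<close> lists the coordinates in the basis enumerated by
    \<open>h\<close>, padded with zeros from index \<open>n\<close> on; \<open>\<Psi>\<close>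
    recombines the first \<open>n\<close> entries.\<close>
  define \<Theta> where "\<Theta> v i = (if i < n then representation B v (h i) else 0)" for v i
  define \<Psi> where "\<Psi> w = (\<Sum>i<n. sc (w i) (h i))" for w
  have \<Theta>_add: "\<Theta> (v + w) = \<Theta> v + \<Theta> w" if "v \<in> M" "w \<in> M" for v w
    using that by (auto simp: \<Theta>_def fun_eq_iff representation_add B(2) M)
  have \<Theta>_diff: "\<Theta> (v - w) = \<Theta> v - \<Theta> w" if "v \<in> M" "w \<in> M" for v w
    using that by (auto simp: \<Theta>_def fun_eq_iff representation_diff B(2) M)
  have \<Theta>_scale: "\<Theta> (sc a v) = ?seq a (\<Theta> v)" if "v \<in> M" for a v
    using that by (auto simp: \<Theta>_def fun_eq_iff representation_scale B(2) M)
  have \<Psi>_add: "\<Psi> (v + w) = \<Psi> v + \<Psi> w" for v w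
    by (simp add: \<Psi>_def scale_left_distrib sum.distrib)
  have \<Psi>_scale: "\<Psi> (?seq a v) = sc a (\<Psi> v)" for a v
    by (simp add: \<Psi>_def scale_sum_right)
  have \<Psi>\<Theta>: "\<Psi> (\<Theta> v) = v" if "v \<in> M" for v
  proof -
    have "\<Psi> (\<Theta> v) = (\<Sum>i<n. sc (representation B v (h i)) (h i))"
      by (simp add: \<Psi>_def \<Theta>_def)
    also have "\<dots> = (\<Sum>b\<in>B. sc (representation B v b) b)"
      unfolding h(1) by (subst sum.reindex[OF h(2)]) (simp add: lessThan_def)
    also have "\<dots> = v"
      by (rule sum_representation_eq) (use that M B(2) \<open>finite B\<close> in auto)
    finally show ?thesis .
  qed
  define act' where "act' \<eta> w = \<Theta> (act \<eta> (\<Psi> w))" for \<eta> w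
  have act': "act' \<eta> (\<Theta> v) = \<Theta> (act \<eta> v)" if "v \<in> M" for \<eta> v
    using that by (simp add: act'_def \<Psi>\<Theta>)
  have \<Theta>_M: "S.subspace (\<Theta> ` M)"
  proof (rule S.subspaceI)
    have "\<Theta> (0 - 0) = \<Theta> 0 - \<Theta> 0" by (rule \<Theta>_diff) (use subspace subspace_0 in auto)
    then have "\<Theta> 0 = 0" by simp
    then show "0 \<in> \<Theta> ` M" using subspace subspace_0 by (metis image_eqI)
  next
    fix x y assume "x \<in> \<Theta> ` M" "y \<in> \<Theta> ` M"
    then show "x + y \<in> \<Theta> ` M"
      using subspace_add[OF subspace] by (auto simp: \<Theta>_add[symmetric])
  next
    fix c x assume "x \<in> \<Theta> ` M"
    then show "?seq c x \<in> \<Theta> ` M"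
      using subspace_scale[OF subspace] by (auto simp: \<Theta>_scale[symmetric])
  qed
  have mod': "differential_module E D ?seq (\<Theta> ` M) act'"
  proof
    show "module.subspace ?seq (\<Theta> ` M)" by (rule \<Theta>_M)
  next
    fix \<eta> m assume "\<eta> \<in> D" "m \<in> \<Theta> ` M"
    then show "act' \<eta> m \<in> \<Theta> ` M" by (auto simp: act' act_closed)
  next
    fix \<eta> \<delta> m assume "\<eta> \<in> D" "\<delta> \<in> D" "m \<in> \<Theta> ` M"
    then show "act' (\<eta> + \<delta>) m = act' \<eta> m + act' \<delta> m"
      by (auto simp: act' act_add_left \<Theta>_add act_closed)
  next
    fix \<eta> m m' assume "\<eta> \<in> D" "m \<in> \<Theta> ` M" "m' \<in> \<Theta> ` M"
    then show "act' \<eta> (m + m') = act' \<eta> m + act' \<eta> m'"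
      by (auto simp: act' act_add_right act_closed subspace_add[OF subspace] \<Theta>_add[symmetric])
  next
    fix \<eta> m a assume "\<eta> \<in> D" "m \<in> \<Theta> ` M"
    then show "act' (scl E a \<eta>) m = ?seq a (act' \<eta> m)"
      by (auto simp: act' act_scl \<Theta>_scale act_closed)
  next
    fix \<eta> m a assume "\<eta> \<in> D" "m \<in> \<Theta> ` M"
    then show "act' \<eta> (?seq a m) = ?seq (der E \<eta> a) m + ?seq a (act' \<eta> m)"
      by (auto simp: act' \<Theta>_scale[symmetric] act_leibniz subspace_scale[OF subspace] act_closed
          \<Theta>_add[symmetric])
  next
    fix \<eta> \<delta> m assume "\<eta> \<in> D" "\<delta> \<in> D" "m \<in> \<Theta> ` M"
    then show "act' (brk E \<eta> \<delta>) m = act' \<eta> (act' \<delta> m) - act' \<delta> (act' \<eta> m)"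
      by (auto simp: act' act_brk \<Theta>_diff act_closed)
  qed
  then interpret M': differential_module E D ?seq "\<Theta> ` M" act' .
  have span': "v \<in> M \<and> \<Theta> v \<in> S.span (\<Theta> ` B)" if "v \<in> span B" for v
    using that
  proof (induction rule: span_induct_alt)
    case base
    have "\<Theta> 0 = 0" by (simp add: \<Theta>_def fun_eq_iff representation_zero)
    then show ?case
      by (simp only: S.span_zero subspace_0[OF subspace])
  next
    case (step c x y)
    then have xy: "x \<in> M" "y \<in> M" by (auto simp: M span_base)
    then have "\<Theta> (sc c x + y) = ?seq c (\<Theta> x) + \<Theta> y"
      by (simp only: \<Theta>_add \<Theta>_scale subspace_scale[OF subspace])
    moreover have "\<Theta> x \<in> S.span (\<Theta> ` B)"
      using step by (intro S.span_base) simp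
    ultimately show ?case
      using step xy subspace_add[OF subspace] subspace_scale[OF subspace]
      by (metis S.span_add S.span_scale)
  qed
  have "finite_dim ?seq (\<Theta> ` M)"
    unfolding finite_dim_def
    by (intro exI[of _ "\<Theta> ` B"] conjI) (use \<open>finite B\<close> span' in \<open>auto simp: M span_base\<close>)
  then have triv: "trivial_module E D ?seq (\<Theta> ` M) act'"
    using closed mod' by (auto simp: linearly_closed_def Let_def)
  show ?thesis
  proof
    fix v assume v: "v \<in> M"
    \<comment> \<open>Going back from sequences: \<open>\<Psi>\<close> sends horizontal vectors of
      the copy to horizontal vectors of \<open>M\<close>, hence also spans to spans.\<close>
    have "\<Psi> w \<in> span (horizontal D M act)" if "w \<in> S.span (horizontal D (\<Theta> ` M) act')" for w
      using that
    proof (induction rule: S.span_induct_alt)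
      case base
      have "\<Psi> 0 = 0" by (simp add: \<Psi>_def)
      then show ?case by (simp only: span_zero)
    next
      case (step c x y)
      from step(1) obtain u where u: "x = \<Theta> u" "u \<in> M" "\<forall>\<eta>\<in>D. act' \<eta> x = 0"
        by (auto simp: horizontal_def)
      have "act \<eta> u = 0" if "\<eta> \<in> D" for \<eta>
      proof -
        have "\<Theta> (act \<eta> u) = 0" using u that by (simp add: act')
        then have "\<Psi> (\<Theta> (act \<eta> u)) = 0" by (simp add: \<Psi>_def)
        then show ?thesis using that u by (simp add: \<Psi>\<Theta> act_closed)
      qed
      then have "u \<in> horizontal D M act" using u by (simp add: horizontal_def)
      moreover have "\<Psi> (?seq c x + y) = sc c u + \<Psi> y"
        by (simp only: \<Psi>_add \<Psi>_scale u(1) \<Psi>\<Theta>[OF u(2)])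
      ultimately show ?case
        using step(2) by (metis span_add span_scale span_base)
    qed
    from this[of "\<Theta> v"] show "v \<in> span (horizontal D M act)"
      using M'.trivial_imp_span_horizontal[OF triv] v by (auto simp: \<Psi>\<Theta>)
  qed
qed

section \<open>Operators compatible with the relative connection\<close>

locale relative_module =
  parameterized_differential_field E F \<phi> s +
  N: differential_module F "relative_der E \<phi> s" sc N act
  for E :: "('k::field_char_0, 'd::ab_group_add) derivation_space"
    and F :: "('K::field_char_0, 'D::ab_group_add) derivation_space"
    and \<phi> :: "'k \<Rightarrow> 'K"
    and s :: "'D \<Rightarrow> ('K \<times> 'd \<Rightarrow>\<^sub>0 int) set"
    and sc :: "'K \<Rightarrow> 'n::ab_group_add \<Rightarrow> 'n"
    and N :: "'n set"
    and act :: "'D \<Rightarrow> 'n \<Rightarrow> 'n" +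
  assumes finite_dim_N: "finite_dim sc N"
begin

abbreviation "R \<equiv> relative_der E \<phi> s"

sublocale n: vector_space sc
  by (rule N.vector_space)

lemmas N_closed = n.subspace_0[OF N.subspace] n.subspace_add[OF N.subspace]
  n.subspace_diff[OF N.subspace] n.subspace_scale[OF N.subspace] n.subspace_sum[OF N.subspace]

text \<open>
  Operators \<open>T\<close> on \<open>N\<close> that satisfy the Leibniz rule for \<open>x\<close> and the flatness condition against
  \<open>D\<^bsub>K/k\<^esub>\<close>. They vanish outside of \<open>N\<close>, so that they are determined by their values on \<open>N\<close>.
\<close>

definition covariant :: "'D \<Rightarrow> ('n \<Rightarrow> 'n) \<Rightarrow> bool" where
  "covariant x T \<longleftrightarrow>
     (\<forall>n\<in>N. T n \<in> N) \<and> (\<forall>n. n \<notin> N \<longrightarrow> T n = 0) \<and> (\<forall>m\<in>N. \<forall>n\<in>N. T (m + n) = T m + T n) \<and>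
     (\<forall>a. \<forall>n\<in>N. T (sc a n) = sc (der F x a) n + sc a (T n)) \<and>
     (\<forall>r\<in>R. \<forall>n\<in>N. act (brk F r x) n = act r (T n) - T (act r n))"

lemma covariantD:
  assumes "covariant x T"
  shows "n \<in> N \<Longrightarrow> T n \<in> N" "n \<notin> N \<Longrightarrow> T n = 0" "m \<in> N \<Longrightarrow> n \<in> N \<Longrightarrow> T (m + n) = T m + T n"
    "n \<in> N \<Longrightarrow> T (sc a n) = sc (der F x a) n + sc a (T n)"
    "r \<in> R \<Longrightarrow> n \<in> N \<Longrightarrow> act (brk F r x) n = act r (T n) - T (act r n)"
  using assms by (auto simp: covariant_def)

lemma covariant_diff_arg: "covariant x T \<Longrightarrow> m \<in> N \<Longrightarrow> n \<in> N \<Longrightarrow> T (m - n) = T m - T n"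
  using covariantD(3)[of x T "m - n" n] by (simp add: N_closed)

lemma covariant_zero_arg: "covariant x T \<Longrightarrow> T 0 = 0"
  using covariant_diff_arg[of x T 0 0] by (simp add: N_closed)

lemma covariant_closed: "covariant x T \<Longrightarrow> T n \<in> N"
  using covariantD(1,2)[of x T n] by (cases "n \<in> N") (auto simp: N_closed)

lemma act_diff: "r \<in> R \<Longrightarrow> m \<in> N \<Longrightarrow> n \<in> N \<Longrightarrow> act r (m - n) = act r m - act r n"
  using N.act_add_right[of r "m - n" n] by (simp add: N_closed)

lemma act_sum: "r \<in> R \<Longrightarrow> (\<And>i. i \<in> A \<Longrightarrow> f i \<in> N) \<Longrightarrow> act r (sum f A) = (\<Sum>i\<in>A. act r (f i))"
proof (induction A rule: infinite_finite_induct)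
  case (insert i A)
  then show ?case by (simp add: N.act_add_right N_closed)
qed (use act_diff[of r 0 0] in \<open>simp_all add: N_closed\<close>)

lemma act_zero_arg: "r \<in> R \<Longrightarrow> act r 0 = 0"
  using act_diff[of r 0 0] by (simp add: N_closed)

lemmas R_closed = K.vs.subspace_0[OF subspace_relative_der] K.vs.subspace_add[OF subspace_relative_der]
  K.vs.subspace_diff[OF subspace_relative_der] K.vs.subspace_scale[OF subspace_relative_der]
  K.vs.subspace_neg[OF subspace_relative_der]

lemma act_zero: "n \<in> N \<Longrightarrow> act 0 n = 0"
  using N.act_add_left[of 0 0 n] by (simp add: R_closed)

lemma act_minus: "r \<in> R \<Longrightarrow> n \<in> N \<Longrightarrow> act (- r) n = - act r n"
  using N.act_add_left[of r "- r" n] by (simp add: R_closed act_zero eq_neg_iff_add_eq_0 add.commute)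

text \<open>The bracket lifts \<open>brk E 0 \<xi>\<close>, which is zero. Hence \<open>act\<close>
  is available on it, as the flatness condition in \<open>covariant\<close> requires.\<close>

lemma brk_relative_lift: "r \<in> R \<Longrightarrow> lifts x \<xi> \<Longrightarrow> brk F r x \<in> R"
  using lifts_brk[of r 0 x \<xi>] by (simp add: relative_der_iff)

lemma der_relative: "r \<in> R \<Longrightarrow> der F r (\<phi> a) = 0"
  using lifts_der[of r 0 a] by (simp add: relative_der_iff)

lemma covariant_add:
  assumes "lifts x \<xi>" "lifts y \<zeta>" "covariant x T" "covariant y S"
  shows "covariant (x + y) (T + S)"
  unfolding covariant_def
  using assms
  by (auto simp: covariantD K.der_add K.brk_add_right N_closed n.scale_left_distrib
      n.scale_right_distrib N.act_add_left N.act_add_right N.act_closed brk_relative_lift)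

lemma covariant_scl:
  assumes "lifts x \<xi>" "covariant x T"
  shows "covariant (scl F (\<phi> a) x) (\<lambda>n. sc (\<phi> a) (T n))"
  unfolding covariant_def
  using assms
  by (auto simp: covariantD K.der_scl K.brk_scl N_closed n.scale_left_distrib mult_ac
      n.scale_right_distrib N.act_scl N.act_leibniz N.act_closed brk_relative_lift der_relative
      n.scale_right_diff_distrib)

text \<open>Flatness of the commutator follows from the Jacobi identity, as the brackets of
  \<open>r\<close> with \<open>x\<close> and \<open>y\<close> again lie in \<open>R\<close> and both
  flatness conditions apply to them.\<close>

lemma covariant_brk:
  assumes x: "lifts x \<xi>" "covariant x T" and y: "lifts y \<zeta>" "covariant y S"
  shows "covariant (brk F x y) (\<lambda>n. T (S n) - S (T n))"
  unfolding covariant_def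
proof (intro conjI allI ballI impI)
  fix n assume "n \<in> N"
  then show "T (S n) - S (T n) \<in> N"
    by (simp add: N_closed covariantD(1)[OF x(2)] covariantD(1)[OF y(2)])
next
  fix n assume "n \<notin> N"
  then show "T (S n) - S (T n) = 0"
    by (simp add: covariantD(2)[OF x(2)] covariantD(2)[OF y(2)] covariant_zero_arg[OF x(2)]
        covariant_zero_arg[OF y(2)])
next
  fix m n assume "m \<in> N" "n \<in> N"
  then show "T (S (m + n)) - S (T (m + n)) = T (S m) - S (T m) + (T (S n) - S (T n))"
    by (simp add: covariantD(1,3)[OF x(2)] covariantD(1,3)[OF y(2)])
next
  fix a n assume "n \<in> N"
  then show "T (S (sc a n)) - S (T (sc a n)) =
      sc (der F (brk F x y) a) n + sc a (T (S n) - S (T n))"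
    by (simp add: covariantD(1,3,4)[OF x(2)] covariantD(1,3,4)[OF y(2)] N_closed K.der_brk
        n.scale_left_diff_distrib n.scale_right_diff_distrib)
next
  fix r n assume r: "r \<in> R" and n: "n \<in> N"
  define r1 where "r1 = brk F r x"
  define r2 where "r2 = brk F r y"
  have R: "r1 \<in> R" "r2 \<in> R"
    using brk_relative_lift[OF r] x(1) y(1) by (auto simp: r1_def r2_def)
  have R': "brk F r1 y \<in> R" "brk F r2 x \<in> R"
    using brk_relative_lift R x(1) y(1) by auto
  note TS = covariantD(1)[OF x(2)] covariantD(1)[OF y(2)]
  have r1: "act r1 m = act r (T m) - T (act r m)" and r2: "act r2 m = act r (S m) - S (act r m)"
    if "m \<in> N" for m
    using covariantD(5)[OF x(2) r that] covariantD(5)[OF y(2) r that] by (simp_all add: r1_def r2_def)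
  have "brk F r (brk F x y) = brk F r1 y + - brk F r2 x"
    using K.jacobi'[of r x y] K.brk_anti[of x r2] by (simp add: r1_def r2_def)
  then have "act (brk F r (brk F x y)) n = act (brk F r1 y) n - act (brk F r2 x) n"
    using R' n by (simp only: N.act_add_left R_closed act_minus) simp
  also have "\<dots> = (act r1 (S n) - S (act r1 n)) - (act r2 (T n) - T (act r2 n))"
    using covariantD(5)[OF y(2) R(1) n] covariantD(5)[OF x(2) R(2) n] by simp
  also have "\<dots> = act r (T (S n) - S (T n)) - (T (S (act r n)) - S (T (act r n)))"
    using r n by (simp add: r1 r2 TS N.act_closed act_diff covariant_diff_arg[OF x(2)]
        covariant_diff_arg[OF y(2)])
  finally show "act (brk F r (brk F x y)) n =
      act r (T (S n) - S (T n)) - (T (S (act r n)) - S (T (act r n)))" .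
qed

section \<open>Finiteness of the space of horizontal endomorphisms\<close>

definition fscale :: "'K \<Rightarrow> ('n \<Rightarrow> 'n) \<Rightarrow> 'n \<Rightarrow> 'n" where
  "fscale a T = (\<lambda>n. sc a (T n))"

sublocale fK: vector_space fscale
  by unfold_locales (auto simp: fscale_def n.scale_left_distrib n.scale_right_distrib fun_eq_iff)

text \<open>Restriction of scalars along \<open>\<phi>\<close>: finiteness is wanted over
  \<open>k\<close>, while the dimension bound comes from \<open>K\<close>.\<close>

sublocale fk: vector_space "\<lambda>a. fscale (\<phi> a)"
  by unfold_locales
    (auto simp: fscale_def n.scale_left_distrib n.scale_right_distrib hom_add hom_mult hom_one fun_eq_iff)

text \<open>Over the zero derivation the Leibniz rule is \<open>K\<close>-linearity, and flatness
  says that the operator commutes with the relative action.\<close>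

definition horizontal_endos :: "('n \<Rightarrow> 'n) set" where
  "horizontal_endos = {A. covariant 0 A}"

lemma horizontal_endosD:
  assumes "A \<in> horizontal_endos" "n \<in> N"
  shows "A (sc a n) = sc a (A n)" "r \<in> R \<Longrightarrow> act r (A n) = A (act r n)"
  using assms covariantD(4)[of 0 A n a] covariantD(5)[of 0 A r n]
  by (simp_all add: horizontal_endos_def act_zero)

lemma sum_apply: "sum f A x = (\<Sum>i\<in>A. f i x)"
  by (induction A rule: infinite_finite_induct) auto

text \<open>
  A relation over \<open>K\<close> expressing one horizontal endomorphism through independent ones has
  coefficients killed by \<open>D\<^bsub>K/k\<^esub>\<close>, which therefore lie in \<open>k\<close>.
\<close>

lemma independent_horizontal_endos:
  assumes "finite S" "S \<subseteq> horizontal_endos" "fk.independent S"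
  shows "fK.independent S"
  using assms
proof (induction S rule: finite_induct)
  case (insert A S)
  then have A: "A \<notin> fk.span S" and kS: "fk.independent S" and A0: "A \<in> horizontal_endos"
    and S0: "\<And>B. B \<in> S \<Longrightarrow> B \<in> horizontal_endos"
    by (auto simp: fk.independent_insert)
  with insert have KS: "fK.independent S" by auto
  have "A \<notin> fK.span S"
  proof
    assume "A \<in> fK.span S"
    then obtain u where u: "A = (\<Sum>B\<in>S. fscale (u B) B)"
      using fK.span_finite[OF insert(1)] by auto
    have "der F r (u B) = 0" if r: "r \<in> R" and B: "B \<in> S" for r B
    proof -
      \<comment> \<open>Apply \<open>r\<close> to the relation expressing \<open>A\<close>: since
        \<open>A\<close> and all \<open>B\<close> commute with \<open>r\<close>, only the terms with
        differentiated coefficients remain, and they sum to zero.\<close>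
      have "(\<Sum>B\<in>S. fscale (der F r (u B)) B) n = 0" for n
      proof (cases "n \<in> N")
        case True
        have BN: "B m \<in> N" if "B \<in> S" "m \<in> N" for B m
          using S0[OF that(1)] that(2) by (auto simp: horizontal_endos_def covariantD)
        have "act r (A n) = (\<Sum>B\<in>S. sc (der F r (u B)) (B n) + sc (u B) (B (act r n)))"
          using True r by (simp add: u sum_apply fscale_def act_sum BN N_closed N.act_leibniz
              horizontal_endosD(2)[OF S0])
        moreover have "A (act r n) = (\<Sum>B\<in>S. sc (u B) (B (act r n)))"
          by (simp add: u sum_apply fscale_def)
        ultimately show ?thesis
          using horizontal_endosD(2)[OF A0 True r] by (simp add: sum_apply fscale_def sum.distrib)
      next
        case False
        then have "B n = 0" if "B \<in> S" for B
          using S0[OF that] by (auto simp: horizontal_endos_def covariantD)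
        then show ?thesis by (auto simp: sum_apply fscale_def intro!: sum.neutral)
      qed
      then have "(\<Sum>B\<in>S. fscale (der F r (u B)) B) = 0" by (simp add: fun_eq_iff)
      from fK.independentD[OF KS insert(1) subset_refl this B] show ?thesis .
    qed
    then have "u B \<in> range \<phi>" if "B \<in> S" for B
      using that by (auto simp: relative_constants[symmetric] constants_def)
    then have "u B = \<phi> (inv_into UNIV \<phi> (u B))" if "B \<in> S" for B
      using that by (simp add: f_inv_into_f)
    then have "A = (\<Sum>B\<in>S. fscale (\<phi> (inv_into UNIV \<phi> (u B))) B)"
      unfolding u by (intro sum.cong refl) simp
    also have "\<dots> \<in> fk.span S"
      by (intro fk.span_sum fk.span_scale fk.span_base)
    finally show False using A by blast
  qed
  then show ?case using KS by (rule fK.independent_insertI)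
qed (rule fK.independent_empty)

text \<open>Matrix units bound the size of sets independent over \<open>K\<close>, and sets of
  horizontal endomorphisms independent over \<open>k\<close> stay independent over
  \<open>K\<close>.\<close>

lemma horizontal_endos_finite_span:
  "\<exists>B. finite B \<and> B \<subseteq> horizontal_endos \<and> horizontal_endos \<subseteq> fk.span B"
proof -
  obtain C where C: "finite C" "C \<subseteq> N" "N \<subseteq> n.span C"
    using finite_dim_N by (auto simp: finite_dim_def)
  obtain B where B: "B \<subseteq> C" "n.independent B" "C \<subseteq> n.span B"
    using n.maximal_independent_subset[of C] by blast
  have fB: "finite B" using B(1) C(1) finite_subset by blast
  have NB: "N \<subseteq> n.span B" using C(3) n.span_mono[OF B(3)] by (simp add: n.span_span)
  have BN: "B \<subseteq> N" using B(1) C(2) by blast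
  have expand: "(\<Sum>b\<in>B. sc (n.representation B n b) b) = n" if "n \<in> N" for n
    by (rule n.sum_representation_eq) (use that NB B(2) fB in auto)
  \<comment> \<open>Matrix units: \<open>e (b, c)\<close> sends the basis vector \<open>b\<close> to
    \<open>c\<close> and the other basis vectors to zero; it vanishes outside of
    \<open>N\<close>.\<close>
  define e where "e p n = (if n \<in> N then sc (n.representation B n (fst p)) (snd p) else 0)" for p n
  have span: "A \<in> fK.span (e ` (B \<times> B))" if A: "A \<in> horizontal_endos" for A
  proof -
    have AN: "A b \<in> N" if "b \<in> N" for b
      using that A by (auto simp: horizontal_endos_def covariantD)
    have A0: "A 0 = 0" and Aadd: "A (m + n) = A m + A n" if "m \<in> N" "n \<in> N" for m n
      using that A covariant_zero_arg by (auto simp: horizontal_endos_def covariantD)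
    have Asum: "A (sum f S) = (\<Sum>i\<in>S. A (f i))" if "\<And>i. i \<in> S \<Longrightarrow> f i \<in> N" for f and S :: "'n set"
      using that by (induction S rule: infinite_finite_induct)
        (use N_closed(1) in \<open>auto simp: A0 Aadd N_closed(5)\<close>)
    have "A n = (\<Sum>b\<in>B. \<Sum>c\<in>B. fscale (n.representation B (A b) c) (e (b, c))) n" for n
    proof (cases "n \<in> N")
      case True
      have "A n = A (\<Sum>b\<in>B. sc (n.representation B n b) b)" using expand[OF True] by simp
      also have "\<dots> = (\<Sum>b\<in>B. sc (n.representation B n b) (A b))"
        using BN by (subst Asum) (auto simp: N_closed horizontal_endosD(1)[OF A] subset_eq intro!: sum.cong)
      also have "\<dots> = (\<Sum>b\<in>B. sc (n.representation B n b) (\<Sum>c\<in>B. sc (n.representation B (A b) c) c))"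
        using BN AN by (intro sum.cong refl) (simp add: expand subset_eq)
      finally show ?thesis using True
        by (simp add: sum_apply fscale_def e_def n.scale_sum_right mult.commute)
    next
      case False
      then show ?thesis
        using A by (simp add: sum_apply fscale_def e_def horizontal_endos_def covariantD)
    qed
    then have "A = (\<Sum>b\<in>B. \<Sum>c\<in>B. fscale (n.representation B (A b) c) (e (b, c)))" by blast
    also have "\<dots> \<in> fK.span (e ` (B \<times> B))"
      by (intro fK.span_sum fK.span_scale fK.span_base) auto
    finally show ?thesis .
  qed
  obtain W where W: "W \<subseteq> horizontal_endos" "fk.independent W" "horizontal_endos \<subseteq> fk.span W"
    using fk.maximal_independent_subset[of horizontal_endos] by blast
  have "finite W"
  proof (rule ccontr)
    assume "infinite W"
    then obtain S where S: "S \<subseteq> W" "finite S" "card S = Suc (card (e ` (B \<times> B)))"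
      using infinite_arbitrarily_large by blast
    have "fK.independent S"
      using independent_horizontal_endos[OF S(2)] S(1) W(1) fk.independent_mono[OF W(2)] by blast
    from fK.independent_span_bound[OF _ this, of "e ` (B \<times> B)"] span S(1,3) W(1) fB
    show False by fastforce
  qed
  with W show ?thesis by blast
qed

end

section \<open>Extending a connection along one step of the filtration\<close>

text \<open>
  The connection \<open>nab\<close> along \<open>D\<close> is to be extended to \<open>D1 = D + k \<theta>\<close>. The form \<open>l\<close> cuts \<open>D\<close> out of
  \<open>D1\<close>, and \<open>T0\<close> is the operator that isomonodromicity along \<open>\<theta>\<close> attaches to the lift \<open>\<delta>0\<close> of \<open>\<theta>\<close>.
\<close>

locale connection_step = relative_module E F \<phi> s sc N act +
  C: differential_module F "der_over_space D" sc N nab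
  for E :: "('k::field_char_0, 'd::ab_group_add) derivation_space"
    and F :: "('K::field_char_0, 'D::ab_group_add) derivation_space"
    and \<phi> :: "'k \<Rightarrow> 'K"
    and s :: "'D \<Rightarrow> ('K \<times> 'd \<Rightarrow>\<^sub>0 int) set"
    and sc :: "'K \<Rightarrow> 'n::ab_group_add \<Rightarrow> 'n"
    and N :: "'n set"
    and act :: "'D \<Rightarrow> 'n \<Rightarrow> 'n"
    and D :: "'d set"
    and nab :: "'D \<Rightarrow> 'n \<Rightarrow> 'n" +
  fixes D1 :: "'d set" and \<theta> :: 'd and l :: "'d \<Rightarrow> 'k" and \<delta>0 :: 'D and T0 :: "'n \<Rightarrow> 'n"
  assumes nab_act: "r \<in> relative_der E \<phi> s \<Longrightarrow> n \<in> N \<Longrightarrow> nab r n = act r n"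
    and D: "lie_subspace E D" and D1: "lie_subspace E D1" and D_D1: "D \<subseteq> D1"
    and l: "semilinear id (scl E) l" and l_\<theta>: "l \<theta> = 1" and \<theta>: "\<theta> \<in> D1"
    and l_D: "\<xi> \<in> D1 \<Longrightarrow> l \<xi> = 0 \<longleftrightarrow> \<xi> \<in> D"
    and \<delta>0: "lifts \<delta>0 \<theta>" and T0: "covariant \<delta>0 T0"
    and closed: "linearly_closed E D"
begin

section \<open>Lifts over \<open>D\<close> and the coordinate along \<open>\<delta>0\<close>\<close>

lemma D_subspace: "k.vs.subspace D" "k.vs.subspace D1"
  and D_brk: "\<eta> \<in> D \<Longrightarrow> \<zeta> \<in> D \<Longrightarrow> brk E \<eta> \<zeta> \<in> D"
  and D1_brk: "\<eta> \<in> D1 \<Longrightarrow> \<zeta> \<in> D1 \<Longrightarrow> brk E \<eta> \<zeta> \<in> D1"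
  using D D1 by (auto simp: lie_subspace_def)

lemma lift_set_subspace:
  assumes "k.vs.subspace S"
  shows "x \<in> lift_set S \<Longrightarrow> y \<in> lift_set S \<Longrightarrow> x + y \<in> lift_set S"
    "x \<in> lift_set S \<Longrightarrow> y \<in> lift_set S \<Longrightarrow> x - y \<in> lift_set S"
    "x \<in> lift_set S \<Longrightarrow> scl F (\<phi> a) x \<in> lift_set S"
    "R \<subseteq> lift_set S"
  unfolding lift_set_def
  by (blast intro: lifts_add lifts_diff lifts_scl k.vs.subspace_add[OF assms]
      k.vs.subspace_diff[OF assms] k.vs.subspace_scale[OF assms])+
    (auto simp: relative_der_iff k.vs.subspace_0[OF assms])

lemma lift_set_mono: "lift_set D \<subseteq> lift_set D1"
  using D_D1 by (auto simp: lift_set_def)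

lemma lift_set_brk:
  "x \<in> lift_set D \<Longrightarrow> y \<in> lift_set D \<Longrightarrow> brk F x y \<in> lift_set D"
  "x \<in> lift_set D1 \<Longrightarrow> y \<in> lift_set D1 \<Longrightarrow> brk F x y \<in> lift_set D1"
  unfolding lift_set_def by (blast intro: lifts_brk D_brk D1_brk)+

lemma lift_set_P: "lift_set D \<subseteq> der_over_space D"
  unfolding der_over_space_def by (rule K.vs.span_superset)

lemma R_P: "R \<subseteq> der_over_space D"
  using lift_set_subspace(4)[OF D_subspace(1)] lift_set_P by blast

lemma P_subspace: "K.vs.subspace (der_over_space D)"
  by (simp add: der_over_space_def)

lemmas P_closed = K.vs.subspace_0[OF P_subspace] K.vs.subspace_add[OF P_subspace]
  K.vs.subspace_diff[OF P_subspace] K.vs.subspace_scale[OF P_subspace] K.vs.subspace_neg[OF P_subspace]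

lemma nab_zero: "n \<in> N \<Longrightarrow> nab 0 n = 0"
  using C.act_add_left[of 0 0 n] by (simp add: P_closed)

lemma nab_diff: "x \<in> der_over_space D \<Longrightarrow> y \<in> der_over_space D \<Longrightarrow> n \<in> N \<Longrightarrow> nab (x - y) n = nab x n - nab y n"
  using C.act_add_left[of "x - y" y n] by (simp add: P_closed)

lemma nab_diff_arg: "x \<in> der_over_space D \<Longrightarrow> m \<in> N \<Longrightarrow> n \<in> N \<Longrightarrow> nab x (m - n) = nab x m - nab x n"
  using C.act_add_right[of x "m - n" n] by (simp add: N_closed)

text \<open>The coordinate along \<open>\<delta>0\<close>: a \<open>K\<close>-linear form with value
  1 there and value 0 on everything over \<open>D\<close>.\<close>

definition \<sigma> :: "'D \<Rightarrow> 'K" where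
  "\<sigma> = pull (\<lambda>\<eta>. \<phi> (l \<eta>))"

lemmas \<sigma>_simps = pull_add[OF semilinear_hom[OF l], folded \<sigma>_def]
  pull_diff[OF semilinear_hom[OF l], folded \<sigma>_def]
  pull_scl[OF semilinear_hom[OF l], folded \<sigma>_def]
  pull_zero[OF semilinear_hom[OF l], folded \<sigma>_def]

lemma \<sigma>_lift: "lifts x \<xi> \<Longrightarrow> \<sigma> x = \<phi> (l \<xi>)"
  unfolding \<sigma>_def by (rule pull_lift[OF semilinear_hom[OF l]])

lemma \<sigma>_\<delta>0: "\<sigma> \<delta>0 = 1"
  using \<sigma>_lift[OF \<delta>0] by (simp add: l_\<theta> hom_one)

lemma \<sigma>_D: "x \<in> lift_set D \<Longrightarrow> \<sigma> x = 0"
  using l_D D_D1 by (auto simp: lift_set_def \<sigma>_lift)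

lemma \<sigma>_eq_0_imp_D: "x \<in> lift_set D1 \<Longrightarrow> \<sigma> x = 0 \<Longrightarrow> x \<in> lift_set D"
  using l_D by (auto simp: lift_set_def \<sigma>_lift)

lemma \<sigma>_P: "x \<in> der_over_space D \<Longrightarrow> \<sigma> x = 0"
  unfolding der_over_space_def
  by (induction rule: K.vs.span_induct_alt) (simp_all add: \<sigma>_simps \<sigma>_D)

definition base :: "'D \<Rightarrow> 'D" where
  "base x = x - scl F (\<sigma> x) \<delta>0"

lemma \<delta>0_D1: "\<delta>0 \<in> lift_set D1"
  using \<delta>0 \<theta> by (auto simp: lift_set_def)

lemma \<sigma>_D1: assumes "x \<in> lift_set D1" obtains a where "\<sigma> x = \<phi> a"
  using assms by (auto simp: lift_set_def \<sigma>_lift)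

text \<open>The coefficient \<open>\<sigma> x\<close> comes from \<open>k\<close>, so subtracting
  this multiple of \<open>\<delta>0\<close> leaves a lift of an element of \<open>D1\<close>, now
  killed by \<open>l\<close>.\<close>

lemma base_D: assumes "x \<in> lift_set D1" shows "base x \<in> lift_set D"
proof (rule \<sigma>_eq_0_imp_D)
  obtain a where "\<sigma> x = \<phi> a" using assms by (rule \<sigma>_D1)
  then show "base x \<in> lift_set D1"
    using assms \<delta>0_D1 by (simp add: base_def lift_set_subspace[OF D_subspace(2)])
  show "\<sigma> (base x) = 0"
    by (simp add: base_def \<sigma>_simps \<sigma>_\<delta>0)
qed

lemma base_add: "base (x + y) = base x + base y"
  by (simp add: base_def \<sigma>_simps K.vs.scale_left_distrib)

lemma base_scl: "base (scl F c x) = scl F c (base x)"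
  by (simp add: base_def \<sigma>_simps K.vs.scale_right_diff_distrib)

text \<open>
  Pairs of a derivation and an operator over it form a Lie algebra \<open>L\<close>, in which the pairs
  \<open>gam y = (y, nab y)\<close> with \<open>y\<close> over \<open>D\<close> form a subalgebra. The quotient is a \<open>D\<close>-module through the
  adjoint action. It is realized on the complement \<open>V\<close>, onto which \<open>proj\<close> projects along this
  subalgebra. The Jacobi identity makes the action flat.
\<close>

definition gam :: "'D \<Rightarrow> 'D \<times> ('n \<Rightarrow> 'n)" where
  "gam y = (y, \<lambda>n. if n \<in> N then nab y n else 0)"

definition pscale :: "'k \<Rightarrow> 'D \<times> ('n \<Rightarrow> 'n) \<Rightarrow> 'D \<times> ('n \<Rightarrow> 'n)" where
  "pscale a p = (scl F (\<phi> a) (fst p), \<lambda>n. sc (\<phi> a) (snd p n))"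

definition pbrk :: "'D \<times> ('n \<Rightarrow> 'n) \<Rightarrow> 'D \<times> ('n \<Rightarrow> 'n) \<Rightarrow> 'D \<times> ('n \<Rightarrow> 'n)" where
  "pbrk p q = (brk F (fst p) (fst q), \<lambda>n. snd p (snd q n) - snd q (snd p n))"

definition L :: "('D \<times> ('n \<Rightarrow> 'n)) set" where
  "L = {p. fst p \<in> lift_set D1 \<and> covariant (fst p) (snd p)}"

definition proj :: "'D \<times> ('n \<Rightarrow> 'n) \<Rightarrow> 'D \<times> ('n \<Rightarrow> 'n)" where
  "proj p = p - gam (base (fst p))"

definition V :: "('D \<times> ('n \<Rightarrow> 'n)) set" where
  "V = {p \<in> L. fst p = scl F (\<sigma> (fst p)) \<delta>0}"

sublocale p: vector_space pscale
  by unfold_locales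
    (auto simp: pscale_def hom_add hom_mult hom_one fun_eq_iff prod_eq_iff K.vs.scale_left_distrib
      K.vs.scale_right_distrib n.scale_left_distrib n.scale_right_distrib)

text \<open>On \<open>R\<close> the connection \<open>nab\<close> is \<open>act\<close>, so its own
  flatness gives the condition required by \<open>covariant\<close>.\<close>

lemma gam_L: assumes "y \<in> lift_set D" shows "gam y \<in> L"
proof -
  have y: "y \<in> der_over_space D" using assms lift_set_P by blast
  obtain \<eta> where \<eta>: "lifts y \<eta>" using assms by (auto simp: lift_set_def)
  have "act (brk F r y) n = act r (nab y n) - nab y (act r n)" if "r \<in> R" "n \<in> N" for r n
    using C.act_brk[of r y n] brk_relative_lift[OF that(1) \<eta>] that R_P y
    by (simp add: nab_act subset_eq C.act_closed)
  then have "covariant y (\<lambda>n. if n \<in> N then nab y n else 0)"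
    using y by (auto simp: covariant_def C.act_closed C.act_add_right C.act_leibniz N_closed N.act_closed)
  then show ?thesis
    using assms lift_set_mono by (auto simp: L_def gam_def)
qed

lemma L_subspace: "p.subspace L"
proof (rule p.subspaceI)
  have "gam 0 \<in> L" by (rule gam_L) (auto simp: lift_set_def k.vs.subspace_0[OF D_subspace(1)] intro: lifts_zero)
  moreover have "gam 0 = 0" by (auto simp: gam_def nab_zero fun_eq_iff prod_eq_iff)
  ultimately show "0 \<in> L" by simp
next
  fix p q assume "p \<in> L" "q \<in> L"
  then show "p + q \<in> L"
    by (auto simp: L_def lift_set_subspace[OF D_subspace(2)] fst_add snd_add)
      (auto simp: lift_set_def intro: covariant_add)
next
  fix c p assume "p \<in> L"
  then show "pscale c p \<in> L"
    by (auto simp: L_def pscale_def lift_set_subspace[OF D_subspace(2)])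
      (auto simp: lift_set_def intro: covariant_scl)
qed

lemmas L_closed = p.subspace_0[OF L_subspace] p.subspace_add[OF L_subspace]
  p.subspace_diff[OF L_subspace] p.subspace_scale[OF L_subspace]

lemma L_brk: "p \<in> L \<Longrightarrow> q \<in> L \<Longrightarrow> pbrk p q \<in> L"
  by (auto simp: L_def pbrk_def lift_set_brk) (auto simp: lift_set_def intro: covariant_brk)

lemma gam_zero: "gam 0 = 0"
  by (auto simp: gam_def nab_zero fun_eq_iff prod_eq_iff)

lemma gam_add: "x \<in> lift_set D \<Longrightarrow> y \<in> lift_set D \<Longrightarrow> gam (x + y) = gam x + gam y"
  using lift_set_P by (auto simp: gam_def C.act_add_left fun_eq_iff prod_eq_iff subset_eq)

lemma gam_diff: "x \<in> lift_set D \<Longrightarrow> y \<in> lift_set D \<Longrightarrow> gam (x - y) = gam x - gam y"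
  using lift_set_P by (auto simp: gam_def nab_diff fun_eq_iff prod_eq_iff subset_eq)

lemma gam_scl: "x \<in> lift_set D \<Longrightarrow> gam (scl F (\<phi> a) x) = pscale a (gam x)"
  using lift_set_P by (auto simp: gam_def pscale_def C.act_scl fun_eq_iff prod_eq_iff subset_eq)

lemma gam_brk:
  assumes "x \<in> lift_set D" "y \<in> lift_set D"
  shows "pbrk (gam x) (gam y) = gam (brk F x y)"
  using assms lift_set_P
  by (auto simp: pbrk_def gam_def C.act_brk C.act_closed fun_eq_iff prod_eq_iff subset_eq N_closed
      nab_diff_arg[of _ 0 0, simplified])

text \<open>A restatement of flatness: the pairs over \<open>R\<close> form an ideal of
  \<open>L\<close>. This will make the adjoint action independent of the choice of lifts.\<close>

lemma pbrk_R_gam: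
  assumes "r \<in> R" "p \<in> L"
  shows "pbrk (gam r) p = gam (brk F r (fst p))"
proof -
  from assms(2) obtain \<xi> where \<xi>: "lifts (fst p) \<xi>" and p: "covariant (fst p) (snd p)"
    by (auto simp: L_def lift_set_def)
  have "brk F r (fst p) \<in> R" by (rule brk_relative_lift[OF assms(1) \<xi>])
  with assms(1) show ?thesis
    by (auto simp: pbrk_def gam_def fun_eq_iff nab_act covariantD[OF p] covariant_zero_arg[OF p] act_zero_arg N_closed)
qed

lemma pbrk_add:
  assumes "p \<in> L" "q \<in> L" "u \<in> L"
  shows "pbrk (p + q) u = pbrk p u + pbrk q u" "pbrk u (p + q) = pbrk u p + pbrk u q"
proof -
  have c: "covariant (fst p) (snd p)" "covariant (fst q) (snd q)" "covariant (fst u) (snd u)"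
    using assms by (auto simp: L_def)
  have "snd u (snd p n + snd q n) = snd u (snd p n) + snd u (snd q n)" for n
    using covariantD(3)[OF c(3)] covariantD(1,2)[OF c(1)] covariantD(1,2)[OF c(2)]
      covariant_zero_arg[OF c(3)]
    by (cases "n \<in> N") auto
  then show "pbrk (p + q) u = pbrk p u + pbrk q u" "pbrk u (p + q) = pbrk u p + pbrk u q"
    by (auto simp: pbrk_def K.brk_add_left K.brk_add_right fun_eq_iff prod_eq_iff)
qed

lemma pbrk_diff:
  assumes "p \<in> L" "q \<in> L" "u \<in> L"
  shows "pbrk (p - q) u = pbrk p u - pbrk q u" "pbrk u (p - q) = pbrk u p - pbrk u q"
  using pbrk_add[of "p - q" q u] assms by (simp_all add: L_closed)

lemma pbrk_jacobi:
  assumes "p \<in> L" "q \<in> L" "u \<in> L"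
  shows "pbrk (pbrk p q) u = pbrk p (pbrk q u) - pbrk q (pbrk p u)"
proof -
  have c: "covariant (fst p) (snd p)" "covariant (fst q) (snd q)" "covariant (fst u) (snd u)"
    using assms by (auto simp: L_def)
  have "snd p (snd q (snd u n)) - snd q (snd p (snd u n)) - snd u (snd p (snd q n) - snd q (snd p n))
    = snd p (snd q (snd u n) - snd u (snd q n)) - snd (pbrk q u) (snd p n) -
     (snd q (snd p (snd u n) - snd u (snd p n)) - snd (pbrk p u) (snd q n))" for n
  proof (cases "n \<in> N")
    case True
    then show ?thesis
      by (simp add: pbrk_def covariant_diff_arg[OF c(1)] covariant_diff_arg[OF c(2)] covariant_diff_arg[OF c(3)]
          covariantD(1)[OF c(1)] covariantD(1)[OF c(2)] covariantD(1)[OF c(3)])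
  next
    case False
    then show ?thesis
      by (simp add: pbrk_def covariant_zero_arg[OF c(1)] covariant_zero_arg[OF c(2)]
          covariant_zero_arg[OF c(3)] covariantD(2)[OF c(1)] covariantD(2)[OF c(2)] covariantD(2)[OF c(3)])
  qed
  then show ?thesis
    by (auto simp: pbrk_def prod_eq_iff fun_eq_iff K.jacobi'[of "fst p" "fst q" "fst u"] algebra_simps)
qed

text \<open>The correction term lies in the subalgebra and is killed by \<open>proj\<close>, so the
  action on the quotient is linear in the derivation.\<close>

lemma pbrk_pscale_left:
  assumes "y \<in> lift_set D" "p \<in> L" "lifts (fst p) \<xi>"
  shows "pbrk (gam (scl F (\<phi> a) y)) p = pscale a (pbrk (gam y) p) - pscale (der E \<xi> a) (gam y)"
proof -
  have p: "covariant (fst p) (snd p)" using assms by (auto simp: L_def)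
  have y: "y \<in> der_over_space D" using assms lift_set_P by blast
  show ?thesis unfolding gam_scl[OF assms(1)]
    using y by (auto simp: pbrk_def pscale_def gam_def prod_eq_iff fun_eq_iff K.brk_scl_left
        lifts_der[OF assms(3)] covariantD[OF p] C.act_closed N_closed
        n.scale_right_diff_distrib covariant_zero_arg[OF p])
qed

lemma pbrk_pscale_right:
  assumes "y \<in> lift_set D" "p \<in> L" "lifts y \<eta>"
  shows "pbrk (gam y) (pscale a p) = pscale (der E \<eta> a) p + pscale a (pbrk (gam y) p)"
proof -
  have p: "covariant (fst p) (snd p)" using assms by (auto simp: L_def)
  have y: "y \<in> der_over_space D" using assms lift_set_P by blast
  show ?thesis
    using y by (auto simp: pbrk_def pscale_def gam_def prod_eq_iff fun_eq_iff K.brk_scl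
        covariant_closed[OF p] lifts_der[OF assms(3)] covariantD[OF p] C.act_closed C.act_leibniz N_closed
        n.scale_right_diff_distrib covariant_zero_arg[OF p])
qed

section \<open>The adjoint action of \<open>D\<close> on the complement \<open>V\<close>\<close>

lemma base_L: "p \<in> L \<Longrightarrow> base (fst p) \<in> lift_set D"
  using base_D by (simp add: L_def)

lemma proj_V: assumes "p \<in> L" shows "proj p \<in> V"
proof -
  have "fst (proj p) = scl F (\<sigma> (fst p)) \<delta>0"
    by (simp add: proj_def gam_def base_def)
  moreover from this have "\<sigma> (fst (proj p)) = \<sigma> (fst p)"
    by (simp add: \<sigma>_simps \<sigma>_\<delta>0)
  moreover have "proj p \<in> L"
    unfolding proj_def using assms gam_L base_L by (simp add: L_closed)
  ultimately show ?thesis by (simp add: V_def)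
qed

lemma V_L: "p \<in> V \<Longrightarrow> p \<in> L"
  by (simp add: V_def)

lemma proj_id: "p \<in> V \<Longrightarrow> proj p = p"
  by (auto simp: V_def proj_def base_def gam_zero)

lemma proj_gam: "y \<in> lift_set D \<Longrightarrow> proj (gam y) = 0"
  by (auto simp: proj_def base_def \<sigma>_D gam_def)

lemma proj_add: "p \<in> L \<Longrightarrow> q \<in> L \<Longrightarrow> proj (p + q) = proj p + proj q"
  by (simp add: proj_def base_add gam_add base_L)

lemma proj_diff: "p \<in> L \<Longrightarrow> q \<in> L \<Longrightarrow> proj (p - q) = proj p - proj q"
  using proj_add[of "p - q" q] by (simp add: L_closed)

lemma proj_pscale: "p \<in> L \<Longrightarrow> proj (pscale a p) = pscale a (proj p)"
  using gam_scl[OF base_L, of p a]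
  by (simp add: proj_def base_scl p.scale_right_diff_distrib) (simp add: pscale_def base_scl)

text \<open>Projection changes \<open>p\<close> by an element of the subalgebra, which stays there
  under the bracket with \<open>gam y\<close>. Hence actions can be composed before
  projecting.\<close>

lemma proj_pbrk_proj:
  assumes "y \<in> lift_set D" "p \<in> L"
  shows "proj (pbrk (gam y) (proj p)) = proj (pbrk (gam y) p)"
proof -
  have "pbrk (gam y) (proj p) = pbrk (gam y) p - gam (brk F y (base (fst p)))"
    unfolding proj_def using assms base_L by (simp add: pbrk_diff gam_L gam_brk)
  then show ?thesis
    using assms base_L by (simp add: proj_diff L_brk gam_L lift_set_brk proj_gam)
qed

definition lift_of :: "'d \<Rightarrow> 'D" where
  "lift_of \<eta> = (SOME y. lifts y \<eta>)"

lemma lift_of: "lifts (lift_of \<eta>) \<eta>"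
  unfolding lift_of_def by (rule someI_ex) (rule lift_exists)

definition adj :: "'d \<Rightarrow> 'D \<times> ('n \<Rightarrow> 'n) \<Rightarrow> 'D \<times> ('n \<Rightarrow> 'n)" where
  "adj \<eta> p = proj (pbrk (gam (lift_of \<eta>)) p)"

text \<open>Two lifts differ by an element of \<open>R\<close>; its bracket with \<open>p\<close>
  lies in the subalgebra, which \<open>proj\<close> kills.\<close>

lemma adj_lift:
  assumes "\<eta> \<in> D" "lifts y \<eta>" "p \<in> L"
  shows "adj \<eta> p = proj (pbrk (gam y) p)"
proof -
  let ?z = "lift_of \<eta>"
  have yz: "y \<in> lift_set D" "?z \<in> lift_set D"
    using assms lift_of by (auto simp: lift_set_def)
  have r: "y - ?z \<in> R"
    using lifts_diff[OF assms(2) lift_of[of \<eta>]] by (simp add: relative_der_iff)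
  from assms(3) obtain \<xi> where \<xi>: "lifts (fst p) \<xi>" by (auto simp: L_def lift_set_def)
  have "pbrk (gam y) p - pbrk (gam ?z) p = pbrk (gam (y - ?z)) p"
    using yz assms by (simp add: pbrk_diff gam_L gam_diff)
  also have "\<dots> = gam (brk F (y - ?z) (fst p))"
    by (rule pbrk_R_gam[OF r assms(3)])
  finally have "proj (pbrk (gam y) p - pbrk (gam ?z) p) = 0"
    using brk_relative_lift[OF r \<xi>] lift_set_subspace(4)[OF D_subspace(1)] proj_gam by auto
  then show ?thesis
    using yz assms by (simp add: proj_diff L_brk gam_L adj_def)
qed

lemma V_subspace: "p.subspace V"
proof (rule p.subspaceI)
  show "0 \<in> V" using L_closed(1) by (simp add: V_def \<sigma>_simps)
next
  fix p q assume "p \<in> V" "q \<in> V"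
  then show "p + q \<in> V"
    using proj_V[of "p + q"] proj_add[of p q] by (simp add: V_L L_closed proj_id)
next
  fix c p assume "p \<in> V"
  then show "pscale c p \<in> V"
    using proj_V[of "pscale c p"] proj_pscale[of p c] by (simp add: V_L L_closed proj_id)
qed

lemma lift_of_D: "\<eta> \<in> D \<Longrightarrow> lift_of \<eta> \<in> lift_set D"
  using lift_of by (auto simp: lift_set_def)

lemma V_module: "differential_module E D pscale V adj"
proof
  show "module.subspace pscale V" by (rule V_subspace)
next
  fix \<eta> p assume "\<eta> \<in> D" "p \<in> V"
  then show "adj \<eta> p \<in> V"
    unfolding adj_def by (intro proj_V L_brk gam_L lift_of_D V_L)
next
  fix \<eta> \<delta> p assume a: "\<eta> \<in> D" "\<delta> \<in> D" "p \<in> V"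
  have "adj (\<eta> + \<delta>) p = proj (pbrk (gam (lift_of \<eta> + lift_of \<delta>)) p)"
    using a by (intro adj_lift lifts_add lift_of V_L k.vs.subspace_add[OF D_subspace(1)])
  then show "adj (\<eta> + \<delta>) p = adj \<eta> p + adj \<delta> p"
    using a by (simp add: gam_add lift_of_D gam_L V_L L_brk proj_add pbrk_add adj_def)
next
  fix \<eta> p q assume a: "\<eta> \<in> D" "p \<in> V" "q \<in> V"
  then show "adj \<eta> (p + q) = adj \<eta> p + adj \<eta> q"
    by (simp add: adj_def lift_of_D gam_L V_L L_brk proj_add pbrk_add)
next
  fix \<eta> p a assume a: "\<eta> \<in> D" "p \<in> V"
  then obtain \<xi> where \<xi>: "lifts (fst p) \<xi>" by (auto simp: V_def L_def lift_set_def)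
  have "adj (scl E a \<eta>) p = proj (pbrk (gam (scl F (\<phi> a) (lift_of \<eta>))) p)"
    using a by (intro adj_lift lifts_scl lift_of V_L k.vs.subspace_scale[OF D_subspace(1)])
  then show "adj (scl E a \<eta>) p = pscale a (adj \<eta> p)"
    using a by (simp add: pbrk_pscale_left[OF _ _ \<xi>] lift_of_D gam_L V_L L_brk L_closed proj_diff
        proj_pscale proj_gam adj_def)
next
  fix \<eta> p a assume a: "\<eta> \<in> D" "p \<in> V"
  then show "adj \<eta> (pscale a p) = pscale (der E \<eta> a) p + pscale a (adj \<eta> p)"
    by (simp add: adj_def pbrk_pscale_right[OF _ _ lift_of] lift_of_D gam_L V_L L_brk L_closed
        proj_add proj_pscale proj_id)
next
  fix \<eta> \<delta> p assume a: "\<eta> \<in> D" "\<delta> \<in> D" "p \<in> V"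
  let ?y = "lift_of \<eta>" and ?z = "lift_of \<delta>"
  \<comment> \<open>The bracket of the chosen lifts is a lift of the bracket, though perhaps not the
    chosen one.\<close>
  have "adj (brk E \<eta> \<delta>) p = proj (pbrk (gam (brk F ?y ?z)) p)"
    using a by (intro adj_lift lifts_brk lift_of V_L D_brk)
  also have "\<dots> = proj (pbrk (gam ?y) (pbrk (gam ?z) p)) - proj (pbrk (gam ?z) (pbrk (gam ?y) p))"
    using a by (simp add: gam_brk[symmetric] lift_of_D pbrk_jacobi gam_L V_L proj_diff L_brk)
  also have "\<dots> = adj \<eta> (adj \<delta> p) - adj \<delta> (adj \<eta> p)"
    using a by (simp add: adj_def proj_pbrk_proj lift_of_D gam_L V_L L_brk)
  finally show "adj (brk E \<eta> \<delta>) p = adj \<eta> (adj \<delta> p) - adj \<delta> (adj \<eta> p)" .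
qed

lemma \<delta>0_V: "(\<delta>0, T0) \<in> V"
  by (simp add: V_def L_def T0 \<delta>0_D1 \<sigma>_\<delta>0)

text \<open>Subtracting a multiple of \<open>(\<delta>0, T0)\<close> leaves a pair over the zero
  derivation, whose operator is a horizontal endomorphism.\<close>

lemma V_finite_dim: "finite_dim pscale V"
proof -
  obtain B where B: "finite B" "B \<subseteq> horizontal_endos" "horizontal_endos \<subseteq> fk.span B"
    using horizontal_endos_finite_span by blast
  let ?B = "insert (\<delta>0, T0) (Pair 0 ` B)"
  have "lifts 0 0" "0 \<in> lift_set D1"
    using lifts_zero k.vs.subspace_0[OF D_subspace(2)] by (auto simp: lift_set_def)
  then have "?B \<subseteq> V"
    using \<delta>0_V B(2) by (auto simp: V_def L_def horizontal_endos_def \<sigma>_simps)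
  moreover have "p \<in> p.span ?B" if p: "p \<in> V" for p
  proof -
    have "fst p \<in> lift_set D1" using p by (auto simp: V_def L_def)
    then obtain f where f: "\<sigma> (fst p) = \<phi> f" by (rule \<sigma>_D1)
    define q where "q = p - pscale f (\<delta>0, T0)"
    have q: "q \<in> L" "fst q = 0"
      using p \<delta>0_V f by (auto simp: q_def L_closed V_L) (simp add: V_def pscale_def)
    then have "snd q \<in> horizontal_endos"
      by (auto simp: L_def horizontal_endos_def)
    then have "snd q \<in> fk.span B" using B(3) by blast
    then have "(0, snd q) \<in> p.span ?B"
    proof (induction rule: fk.span_induct_alt)
      case base
      then show ?case using p.span_zero unfolding zero_prod_def .
    next
      case (step c x y)
      have "(0, fscale (\<phi> c) x + y) = pscale c (0, x) + (0, y)"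
        by (simp add: pscale_def fscale_def)
      then show ?case using step
        by (metis insertCI imageI p.span_add p.span_base p.span_scale)
    qed
    moreover have "p = (0, snd q) + pscale f (\<delta>0, T0)"
      using q(2) by (metis q_def diff_add_cancel prod.collapse)
    ultimately show ?thesis
      by (metis insertCI p.span_add p.span_base p.span_scale)
  qed
  ultimately show ?thesis
    unfolding finite_dim_def by (intro exI[of _ ?B]) (use B(1) in auto)
qed

text \<open>
  The horizontal vectors span \<open>V\<close>, so one of them lies outside the hyperplane \<open>\<sigma> = 0\<close>: it
  corrects \<open>T0\<close> to an operator that is flat against \<open>nab\<close>.
\<close>

lemma flat_operator_exists:
  obtains x T where "x \<in> lift_set D1" "covariant x T" "\<sigma> x \<noteq> 0"
    "\<And>y. y \<in> lift_set D \<Longrightarrow> brk F y x \<in> lift_set D"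
    "\<And>y n. y \<in> lift_set D \<Longrightarrow> n \<in> N \<Longrightarrow> nab (brk F y x) n = nab y (T n) - T (nab y n)"
proof -
  interpret V: differential_module E D pscale V adj by (rule V_module)
  have span: "V \<subseteq> p.span (horizontal D V adj)"
    by (rule V.linearly_closed_imp_span_horizontal[OF closed V_finite_dim k.differential_field_axioms])
  obtain p where p: "p \<in> horizontal D V adj" "\<sigma> (fst p) \<noteq> 0"
  proof (rule ccontr)
    assume "\<not> thesis"
    with that have zero: "\<And>p. p \<in> horizontal D V adj \<Longrightarrow> \<sigma> (fst p) = 0" by blast
    \<comment> \<open>Otherwise \<open>\<sigma>\<close> would vanish on the span, hence on
      \<open>(\<delta>0, T0)\<close>, where it is 1.\<close>
    have "\<sigma> (fst p) = 0" if "p \<in> p.span (horizontal D V adj)" for p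
      using that by (induction rule: p.span_induct_alt) (simp_all add: \<sigma>_simps zero pscale_def)
    then show False using span \<delta>0_V \<sigma>_\<delta>0 by force
  qed
  then have pL: "p \<in> L" and cov: "covariant (fst p) (snd p)" and x: "fst p \<in> lift_set D1"
    by (auto simp: horizontal_def V_def L_def)
  \<comment> \<open>Horizontality means that the bracket with \<open>gam y\<close> has zero
    projection, so it lies in the subalgebra; its first component then lies over \<open>D\<close>,
    and its second is the flatness equation.\<close>
  have flat: "pbrk (gam y) p = gam (base (brk F y (fst p)))" if y: "y \<in> lift_set D" for y
  proof -
    from y obtain \<eta> where \<eta>: "\<eta> \<in> D" "lifts y \<eta>" by (auto simp: lift_set_def)
    then have "proj (pbrk (gam y) p) = 0"
      using p(1) adj_lift[OF \<eta> pL] by (simp add: horizontal_def)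
    moreover have "fst (pbrk (gam y) p) = brk F y (fst p)"
      by (simp add: pbrk_def gam_def)
    ultimately show ?thesis by (simp add: proj_def)
  qed
  show thesis
  proof (rule that[of "fst p" "snd p"])
    fix y assume y: "y \<in> lift_set D"
    have eq: "brk F y (fst p) = base (brk F y (fst p))"
      using arg_cong[OF flat[OF y], of fst] by (simp add: pbrk_def gam_def)
    moreover have "base (brk F y (fst p)) \<in> lift_set D"
      using y x lift_set_mono by (intro base_D lift_set_brk) auto
    ultimately show "brk F y (fst p) \<in> lift_set D" by simp
    fix n assume n: "n \<in> N"
    have "snd (pbrk (gam y) p) n = snd (gam (brk F y (fst p))) n"
      using flat[OF y] eq by simp
    then show "nab (brk F y (fst p)) n = nab y (snd p n) - snd p (nab y n)"
      using n covariant_closed[OF cov] by (simp add: pbrk_def gam_def)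
  qed (use p cov x in auto)
qed

section \<open>The extended connection and its flatness\<close>

lemma P_brk:
  assumes "y \<in> der_over_space D" "z \<in> der_over_space D"
  shows "brk F y z \<in> der_over_space D"
proof -
  \<comment> \<open>Differentiating a coefficient only adds multiples of lifts over
    \<open>D\<close>, so brackets remain in the \<open>K\<close>-span.\<close>
  have right: "brk F x w \<in> der_over_space D" if "x \<in> lift_set D" "w \<in> der_over_space D" for x w
    using that(2) unfolding der_over_space_def
  proof (induction rule: K.vs.span_induct_alt)
    case base
    show ?case by (simp add: K.vs.span_zero)
  next
    case (step c a w)
    then show ?case using lift_set_brk(1)[OF that(1)]
      by (simp add: K.brk_add_right K.brk_scl K.vs.span_add K.vs.span_scale K.vs.span_base)
  qed
  have "brk F y z \<in> der_over_space D \<and> y \<in> der_over_space D"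
    using assms(1) unfolding der_over_space_def[of D]
  proof (induction rule: K.vs.span_induct_alt)
    case base
    show ?case by (simp add: K.vs.span_zero)
  next
    case (step c a y)
    then show ?case using right[OF step(1) assms(2)]
      unfolding der_over_space_def
      by (simp add: K.brk_add_left K.brk_scl_left K.vs.span_add K.vs.span_scale K.vs.span_base
          K.vs.span_diff)
  qed
  then show ?thesis ..
qed

text \<open>The space over \<open>D1\<close> is the sum of the space over \<open>D\<close> and the
  line \<open>K x\<close>. Let \<open>x\<close> act by \<open>T\<close>: flatness against
  \<open>D\<close> is the choice of \<open>T\<close>, and \<open>x\<close> commutes with
  itself.\<close>

lemma extend_connection:
  "\<exists>nab'. differential_module F (der_over_space D1) sc N nab' \<and>
     (\<forall>r\<in>relative_der E \<phi> s. \<forall>n\<in>N. nab' r n = act r n)"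
proof -
  obtain x T where x: "x \<in> lift_set D1" and T: "covariant x T" and \<sigma>x: "\<sigma> x \<noteq> 0"
    and closed: "\<And>y. y \<in> lift_set D \<Longrightarrow> brk F y x \<in> lift_set D"
    and flat: "\<And>y n. y \<in> lift_set D \<Longrightarrow> n \<in> N \<Longrightarrow> nab (brk F y x) n = nab y (T n) - T (nab y n)"
    by (rule flat_operator_exists) blast
  note TN = covariantD(1)[OF T] and T_add = covariantD(3)[OF T] and T_scl = covariantD(4)[OF T]
  \<comment> \<open>Flatness is known on lifts; this extends it to their \<open>K\<close>-span,
    where the Leibniz rule of \<open>T\<close> matches the derivative of the coefficient.\<close>
  have xP: "brk F y x \<in> der_over_space D \<and>
      (\<forall>n\<in>N. nab (brk F y x) n = nab y (T n) - T (nab y n)) \<and> y \<in> der_over_space D"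
    if "y \<in> der_over_space D" for y
    using that unfolding der_over_space_def
  proof (induction rule: K.vs.span_induct_alt)
    case base
    show ?case
      by (auto simp: K.vs.span_zero nab_zero covariant_zero_arg[OF T] TN)
  next
    case (step c a y)
    then have a: "a \<in> der_over_space D" "brk F a x \<in> der_over_space D" "a \<in> lift_set D"
      using lift_set_P closed by auto
    have y: "y \<in> der_over_space D" "brk F y x \<in> der_over_space D"
      and ny: "\<And>n. n \<in> N \<Longrightarrow> nab (brk F y x) n = nab y (T n) - T (nab y n)"
      using step by (auto simp: der_over_space_def)
    let ?z = "scl F c a + y"
    have eq: "brk F ?z x = scl F c (brk F a x) - scl F (der F x c) a + brk F y x"
      by (simp add: K.brk_add_left K.brk_scl_left)
    have "nab (brk F ?z x) n = nab ?z (T n) - T (nab ?z n)" if n: "n \<in> N" for n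
    proof -
      have "nab (brk F ?z x) n = sc c (nab a (T n) - T (nab a n)) - sc (der F x c) (nab a n)
          + (nab y (T n) - T (nab y n))"
        unfolding eq using a y n
        by (simp add: C.act_add_left nab_diff C.act_scl P_closed flat ny)
      also have "\<dots> = nab ?z (T n) - T (nab ?z n)"
        using a y n by (simp add: C.act_add_left C.act_scl P_closed TN T_add T_scl C.act_closed N_closed
            n.scale_right_diff_distrib)
      finally show ?thesis .
    qed
    moreover have "brk F ?z x \<in> der_over_space D" "?z \<in> der_over_space D"
      unfolding eq using a y by (auto simp: P_closed)
    ultimately show ?case by (simp add: der_over_space_def)
  qed
  \<comment> \<open>\<open>c\<close> and \<open>b\<close> are the two components of the
    decomposition along \<open>x\<close>.\<close>
  define c where "c z = \<sigma> z / \<sigma> x" for z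
  define b where "b z = z - scl F (c z) x" for z
  have c_simps: "c (y + z) = c y + c z" "c (scl F a z) = a * c z" "c 0 = 0" for y z a
    by (simp_all add: c_def \<sigma>_simps add_divide_distrib)
  have b_simps: "b (y + z) = b y + b z" "b (scl F a z) = scl F a (b z)" "b 0 = 0" for y z a
    by (simp_all add: b_def c_simps K.vs.scale_left_distrib K.vs.scale_right_diff_distrib)
  have bP: "b z \<in> der_over_space D" if "z \<in> der_over_space D1" for z
    using that unfolding der_over_space_def[of D1]
  proof (induction rule: K.vs.span_induct_alt)
    case base
    then show ?case by (simp add: b_simps P_closed)
  next
    case (step a z w)
    \<comment> \<open>Both values of \<open>\<sigma>\<close> come from \<open>k\<close>, hence so
      does their quotient, and \<open>b z\<close> is again a lift.\<close>
    obtain f g where fg: "\<sigma> z = \<phi> f" "\<sigma> x = \<phi> g"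
      using \<sigma>_D1 step(1) x by metis
    then have "c z = \<phi> (f * inverse g)"
      by (simp add: c_def hom_mult hom_inverse divide_inverse)
    then have "b z \<in> lift_set D1"
      using step(1) x by (simp add: b_def lift_set_subspace[OF D_subspace(2)])
    moreover have "\<sigma> (b z) = 0"
      using \<sigma>x by (simp add: b_def c_def \<sigma>_simps)
    ultimately have "b z \<in> der_over_space D"
      using \<sigma>_eq_0_imp_D lift_set_P by blast
    then show ?case using step(2) by (simp add: b_simps P_closed)
  qed
  have decomp: "z = b z + scl F (c z) x" for z by (simp add: b_def)
  have unique: "c (u + scl F e x) = e" "b (u + scl F e x) = u" if "u \<in> der_over_space D" for u e
    using \<sigma>_P[OF that] \<sigma>x by (simp_all add: c_def b_def \<sigma>_simps)
  define nab' where "nab' z n = nab (b z) n + sc (c z) (T n)" for z n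
  have "differential_module F (der_over_space D1) sc N nab'"
  proof
    show "module.subspace sc N" by (rule N.subspace)
  next
    fix z n assume "z \<in> der_over_space D1" "n \<in> N"
    then show "nab' z n \<in> N" by (simp add: nab'_def C.act_closed N_closed TN bP)
  next
    fix y z n assume "y \<in> der_over_space D1" "z \<in> der_over_space D1" "n \<in> N"
    then show "nab' (y + z) n = nab' y n + nab' z n"
      by (simp add: nab'_def b_simps c_simps C.act_add_left bP n.scale_left_distrib)
  next
    fix z m n assume "z \<in> der_over_space D1" "m \<in> N" "n \<in> N"
    then show "nab' z (m + n) = nab' z m + nab' z n"
      by (simp add: nab'_def C.act_add_right T_add bP n.scale_right_distrib)
  next
    fix z n a assume "z \<in> der_over_space D1" "n \<in> N"
    then show "nab' (scl F a z) n = sc a (nab' z n)"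
      by (simp add: nab'_def b_simps c_simps C.act_scl bP n.scale_right_distrib)
  next
    fix z n a assume zn: "z \<in> der_over_space D1" "n \<in> N"
    have "der F z a = der F (b z) a + c z * der F x a"
      by (subst decomp[of z]) (simp add: K.der_add K.der_scl)
    with zn show "nab' z (sc a n) = sc (der F z a) n + sc a (nab' z n)"
      by (simp add: nab'_def C.act_leibniz T_scl bP n.scale_right_distrib n.scale_left_distrib
          mult.commute)
  next
    fix y z n assume "y \<in> der_over_space D1" "z \<in> der_over_space D1" and n: "n \<in> N"
    then have P: "b y \<in> der_over_space D" "b z \<in> der_over_space D" by (simp_all add: bP)
    note Px = xP[OF P(1)] xP[OF P(2)]
    define p q where "p = b y" and "q = b z"
    define f g where "f = c y" and "g = c z"
    have yz: "y = p + scl F f x" "z = q + scl F g x"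
      using decomp by (simp_all add: p_def q_def f_def g_def)
    have PQ: "p \<in> der_over_space D" "q \<in> der_over_space D"
      "brk F p x \<in> der_over_space D" "brk F q x \<in> der_over_space D"
      using P Px by (simp_all add: p_def q_def)
    have nabx: "nab (brk F p x) n = nab p (T n) - T (nab p n)" "nab (brk F q x) n = nab q (T n) - T (nab q n)"
      using n Px by (simp_all add: p_def q_def)
    have pq: "brk F p q \<in> der_over_space D"
      using PQ by (intro P_brk)
    \<comment> \<open>\<open>u\<close> and \<open>e\<close> are the components of the bracket of
      \<open>p + f x\<close> and \<open>q + g x\<close>: the derivatives of \<open>f\<close> and
      \<open>g\<close> contribute only multiples of \<open>x\<close>.\<close>
    define u where "u = brk F p q + scl F g (brk F p x) - scl F f (brk F q x)"
    define e where "e = der F y g - der F z f"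
    have u: "u \<in> der_over_space D"
      unfolding u_def using PQ pq by (intro P_closed)
    have "brk F y z = u + scl F e x"
      unfolding yz(1) yz(2) e_def u_def
      by (simp add: K.brk_add_left K.brk_add_right K.brk_scl_left K.brk_scl K.brk_self
          K.der_add K.der_scl K.vs.scale_left_distrib K.vs.scale_left_diff_distrib
          K.vs.scale_right_distrib K.vs.scale_right_diff_distrib K.brk_anti[of x] algebra_simps)
    then have "nab' (brk F y z) n = nab u n + sc e (T n)"
      by (simp add: nab'_def unique[OF u])
    also have "nab u n = nab p (nab q n) - nab q (nab p n) + sc g (nab p (T n) - T (nab p n))
        - sc f (nab q (T n) - T (nab q n))"
      unfolding u_def using PQ pq n
      by (simp add: nab_diff C.act_add_left C.act_scl P_closed nabx C.act_brk)
    also have "\<dots> + sc e (T n) = nab' y (nab' z n) - nab' z (nab' y n)"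
    proof -
      have y': "nab' y m = nab p m + sc f (T m)" and z': "nab' z m = nab q m + sc g (T m)" for m
        by (simp_all add: nab'_def p_def q_def f_def g_def)
      have "der F y g = der F p g + f * der F x g" "der F z f = der F q f + g * der F x f"
        unfolding yz(1) yz(2) by (simp_all add: K.der_add K.der_scl)
      then show ?thesis
        using PQ n unfolding y' z' e_def
        by (simp add: C.act_add_right C.act_leibniz C.act_closed TN T_add T_scl N_closed
            n.scale_left_distrib n.scale_left_diff_distrib n.scale_right_distrib
            n.scale_right_diff_distrib algebra_simps)
    qed
    finally show "nab' (brk F y z) n = nab' y (nab' z n) - nab' z (nab' y n)" .
  qed
  moreover have "nab' r n = act r n" if "r \<in> R" "n \<in> N" for r n
    using that R_P \<sigma>_P[of r] by (auto simp: nab'_def b_def c_def nab_act)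
  ultimately show ?thesis by blast
qed

end


section \<open>The equivalence\<close>

text \<open>A basis of \<open>S\<close> and one vector outside it span \<open>S'\<close> by
  counting; \<open>l\<close> is the coordinate of that vector.\<close>

lemma (in differential_field) codimension_one:
  assumes S: "vs.subspace S" "vs.subspace S'" "S \<subseteq> S'" and dim: "vs.dim S' = vs.dim S + 1"
  obtains \<theta> l where "\<theta> \<in> S'" "semilinear id (scl E) l" "l \<theta> = 1" "\<And>\<xi>. \<xi> \<in> S' \<Longrightarrow> l \<xi> = 0 \<longleftrightarrow> \<xi> \<in> S"
proof -
  interpret vector_space_pair "scl E" "(*) :: 'k \<Rightarrow> 'k \<Rightarrow> 'k"
    by unfold_locales (auto simp: algebra_simps vs.scale_right_distrib vs.scale_left_distrib)
  obtain B where B: "B \<subseteq> S" "vs.independent B" "S \<subseteq> vs.span B" "card B = vs.dim S"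
    using vs.basis_exists[of S] by blast
  have SB: "vs.span B = S" using B S vs.span_subspace by blast
  from dim have "S \<noteq> S'" by auto
  then obtain \<theta> where \<theta>: "\<theta> \<in> S'" "\<theta> \<notin> S" using S(3) by blast
  then have ind: "vs.independent (insert \<theta> B)"
    using B SB by (intro vs.independent_insertI) auto
  obtain C where C: "finite C" "vs.independent C" "vs.span C = UNIV"
    by (rule finite_basis)
  have fin: "finite X" if "vs.independent X" for X
    using vs.independent_span_bound[OF C(1) that] C(3) by simp
  obtain B' where B': "insert \<theta> B \<subseteq> B'" "B' \<subseteq> S'" "vs.independent B'" "S' \<subseteq> vs.span B'"
    using vs.maximal_independent_subset_extend[OF _ ind, of S'] \<theta>(1) B(1) S(3) by (metis insert_subset subset_trans)
  have "card B' = card (insert \<theta> B)"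
  proof -
    have "\<theta> \<notin> B" using B(1) \<theta>(2) by blast
    then show ?thesis
      using vs.basis_card_eq_dim[OF B'(2,4,3)] dim B(4) fin[OF B(2)] by simp
  qed
  then have "insert \<theta> B = B'"
    using card_subset_eq[OF fin[OF B'(3)] B'(1)] by simp
  with B'(4) have S': "S' \<subseteq> vs.span (insert \<theta> B)" by simp
  obtain l where l: "Vector_Spaces.linear (scl E) (*) l" "\<And>x. x \<in> insert \<theta> B \<Longrightarrow> l x = (if x = \<theta> then 1 else 0)"
    using linear_independent_extend[OF ind, of "\<lambda>x. if x = \<theta> then 1 else 0"] by blast
  then have lin: "l (x + y) = l x + l y" "l (scl E a x) = a * l x" for x y a
    using linear_add[OF l(1)] linear_scale[OF l(1)] by auto
  have l0: "l x = 0" if "x \<in> S" for x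
    using that unfolding SB[symmetric]
  proof (induction rule: vs.span_induct_alt)
    case base
    show ?case using lin(1)[of 0 0] by simp
  next
    case (step c x y)
    then have "l x = 0" using l(2)[of x] \<theta>(2) B(1) by auto
    then show ?case using step by (simp add: lin)
  qed
  show thesis
  proof (rule that[of \<theta> l])
    fix \<xi> assume "\<xi> \<in> S'"
    then obtain c where c: "\<xi> - scl E c \<theta> \<in> S"
      using S' SB vs.span_breakdown_eq[of \<xi> \<theta> B] by auto
    have "l \<xi> = l (\<xi> - scl E c \<theta>) + l (scl E c \<theta>)" by (simp add: lin(1)[symmetric])
    then have "l \<xi> = c" using l0[OF c] l(2)[of \<theta>] by (simp add: lin)
    then show "l \<xi> = 0 \<longleftrightarrow> \<xi> \<in> S" using c l0 by auto
  qed (use \<theta> l(2)[of \<theta>] lin in \<open>auto simp: semilinear_def\<close>)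
qed

context relative_module
begin

text \<open>For a lift \<open>x\<close>, take the operator by which the extended action applies
  \<open>x\<close>; brackets with \<open>R\<close> stay in \<open>R\<close>, where that action is
  the given one.\<close>

lemma isomonodromic_along_imp_covariant:
  assumes "isomonodromic_along E F \<phi> s \<eta> sc N act"
  shows "\<exists>x T. lifts x \<eta> \<and> covariant x T"
proof -
  let ?D = "der_over E \<phi> s \<eta>"
  obtain act' where mod': "differential_module F ?D sc N act'"
    and act': "\<And>\<delta> n. \<delta> \<in> R \<Longrightarrow> n \<in> N \<Longrightarrow> act' \<delta> n = act \<delta> n"
    using assms by (auto simp: isomonodromic_along_def extends_action_def)
  interpret A: differential_module F ?D sc N act' by (rule mod')
  obtain x where x: "lifts x \<eta>" using lift_exists by blast
  have xD: "x \<in> ?D" using x by (auto simp: lifts_def der_over_def)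
  have RD: "R \<subseteq> ?D"
  proof
    fix r assume "r \<in> R"
    \<comment> \<open>The zero tensor is also \<open>0 \<otimes> \<eta>\<close>, so \<open>R\<close>
      lies over every line.\<close>
    then have "s r = tensor_class UNIV \<phi> UNIV (scl E) (frag_of (0, \<eta>))"
      by (simp add: relative_der_def one_tensor_full tensor_class_eq_iff full_kernel_minus
          frag_of_zero_left)
    then show "r \<in> ?D" by (auto simp: der_over_def)
  qed
  have "act (brk F r x) n = act r (act' x n) - act' x (act r n)" if "r \<in> R" "n \<in> N" for r n
    using A.act_brk[of r x n] brk_relative_lift[OF that(1) x] that RD xD
    by (simp add: act' A.act_closed subset_eq)
  then have "covariant x (\<lambda>n. if n \<in> N then act' x n else 0)"
    using xD by (auto simp: covariant_def A.act_closed A.act_add_right A.act_leibniz N_closed N.act_closed)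
  with x show ?thesis by blast
qed

text \<open>Operators over lifts can be added and scaled by \<open>k\<close>, so a spanning set
  suffices.\<close>

lemma covariant_exists:
  assumes span: "k.vs.span S = UNIV" and S: "\<And>\<eta>. \<eta> \<in> S \<Longrightarrow> \<exists>x T. lifts x \<eta> \<and> covariant x T"
  shows "\<exists>x T. lifts x \<eta> \<and> covariant x T"
proof -
  have "\<eta> \<in> k.vs.span S" by (simp add: span)
  then show ?thesis
  proof (induction rule: k.vs.span_induct_alt)
    case base
    have "covariant 0 (\<lambda>_. 0)"
      by (auto simp: covariant_def N_closed act_zero act_zero_arg)
    then show ?case using lifts_zero by blast
  next
    case (step c \<eta> \<zeta>)
    then obtain x T y U where "lifts x \<eta>" "covariant x T" "lifts y \<zeta>" "covariant y U"
      using S by blast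
    then show ?case
      using covariant_add[OF lifts_scl _ covariant_scl] lifts_add[OF lifts_scl] by blast
  qed
qed

text \<open>Induction along the filtration, from the relative action over \<open>{0}\<close> to an
  action of all of \<open>D\<^sub>K\<close>.\<close>

lemma isomonodromic_if_covariant:
  assumes cov: "\<And>\<eta>. \<exists>x T. lifts x \<eta> \<and> covariant x T" and filt: "filtered_linearly_closed E"
  shows "isomonodromic E F \<phi> s sc N act"
proof -
  from filt obtain d D where lie: "\<forall>i\<le>d. lie_subspace E (D i)"
    and D0: "D 0 = {0}" and Dd: "D d = UNIV"
    and step: "\<forall>i<d. D i \<subseteq> D (Suc i) \<and> k.vs.dim (D (Suc i)) = k.vs.dim (D i) + 1
      \<and> linearly_closed E (D i)"
    unfolding filtered_linearly_closed_def by (elim exE conjE)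
  have "i \<le> d \<Longrightarrow> \<exists>nab. differential_module F (der_over_space (D i)) sc N nab \<and>
      (\<forall>r\<in>R. \<forall>n\<in>N. nab r n = act r n)" for i
  proof (induction i)
    case 0
    then show ?case using N.differential_module_axioms by (auto simp: D0 der_over_space_0)
  next
    case (Suc i)
    then obtain nab where nab: "differential_module F (der_over_space (D i)) sc N nab"
      "\<And>r n. r \<in> R \<Longrightarrow> n \<in> N \<Longrightarrow> nab r n = act r n" by auto
    have i: "i < d" using Suc by simp
    then have lie': "lie_subspace E (D i)" "lie_subspace E (D (Suc i))"
      and step': "D i \<subseteq> D (Suc i)" "k.vs.dim (D (Suc i)) = k.vs.dim (D i) + 1"
        "linearly_closed E (D i)"
      using lie step by auto
    have sub: "k.vs.subspace (D i)" "k.vs.subspace (D (Suc i))"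
      using lie' by (auto simp: lie_subspace_def)
    obtain \<theta> l where \<theta>: "\<theta> \<in> D (Suc i)" "semilinear id (scl E) l" "l \<theta> = 1"
      "\<And>\<xi>. \<xi> \<in> D (Suc i) \<Longrightarrow> l \<xi> = 0 \<longleftrightarrow> \<xi> \<in> D i"
      using k.codimension_one[OF sub step'(1,2)] by blast
    \<comment> \<open>The vector \<open>\<theta>\<close> comes from the filtration and may differ
      from the given basis vectors; an operator over it still exists.\<close>
    obtain \<delta>0 T0 where "lifts \<delta>0 \<theta>" "covariant \<delta>0 T0" using cov by blast
    then interpret connection_step E F \<phi> s sc N act "D i" nab "D (Suc i)" \<theta> l \<delta>0 T0
      by (intro connection_step.intro connection_step_axioms.intro relative_module_axioms nab \<theta>
          lie' step')
    show ?case by (rule extend_connection)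
  qed
  from this[of d] show ?thesis
    by (auto simp: Dd der_over_space_UNIV isomonodromic_def extends_action_def)
qed

end

lemma differential_module_restrict:
  assumes "differential_module F D sc N act" "D' \<subseteq> D"
  shows "differential_module F D' sc N act"
  using assms unfolding differential_module_def by (meson subsetD)

theorem theorem6p3:
  fixes E :: "('k::field_char_0, 'd::ab_group_add) derivation_space"
    and F :: "('K::field_char_0, 'D::ab_group_add) derivation_space"
    and \<phi> :: "'k \<Rightarrow> 'K"
    and s :: "'D \<Rightarrow> ('K \<times> 'd \<Rightarrow>\<^sub>0 int) set"
    and sc :: "'K \<Rightarrow> 'n::ab_group_add \<Rightarrow> 'n"
    and N :: "'n set"
    and act :: "'D \<Rightarrow> 'n \<Rightarrow> 'n"
  assumes "differential_field E"
    and "parameterized_differential_field E F \<phi> s"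
    and "differential_module F (relative_der E \<phi> s) sc N act"
    and "finite_dim sc N"
    and "filtered_linearly_closed E"
  shows "isomonodromic E F \<phi> s sc N act \<longleftrightarrow>
    (\<exists>(d::nat) \<eta> :: nat \<Rightarrow> 'd.
       inj_on \<eta> {1..d} \<and>
       module.independent (scl E) (\<eta> ` {1..d}) \<and>
       module.span (scl E) (\<eta> ` {1..d}) = UNIV \<and>
       (\<forall>i\<in>{1..d}. isomonodromic_along E F \<phi> s (\<eta> i) sc N act))"
proof -
  interpret relative_module E F \<phi> s sc N act
    using assms by (intro relative_module.intro relative_module_axioms.intro)
  show ?thesis
  proof
    assume iso: "isomonodromic E F \<phi> s sc N act"
    obtain B where B: "finite B" "k.vs.independent B" "k.vs.span B = UNIV"
      by (rule k.finite_basis)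
    obtain \<eta> where \<eta>: "bij_betw \<eta> {1..card B} B"
      using ex_bij_betw_nat_finite_1[OF B(1)] by blast
    \<comment> \<open>An action of all of \<open>D\<^sub>K\<close> restricts to the part over any
      line, so every basis works.\<close>
    have "isomonodromic_along E F \<phi> s \<zeta> sc N act" for \<zeta>
      using iso differential_module_restrict[OF _ subset_UNIV]
      unfolding isomonodromic_def isomonodromic_along_def extends_action_def by blast
    with \<eta> B show "\<exists>(d::nat) \<eta> :: nat \<Rightarrow> 'd.
       inj_on \<eta> {1..d} \<and>
       module.independent (scl E) (\<eta> ` {1..d}) \<and>
       module.span (scl E) (\<eta> ` {1..d}) = UNIV \<and>
       (\<forall>i\<in>{1..d}. isomonodromic_along E F \<phi> s (\<eta> i) sc N act)"
      by (intro exI[of _ "card B"] exI[of _ \<eta>]) (simp add: bij_betw_def)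
  next
    assume "\<exists>(d::nat) \<eta> :: nat \<Rightarrow> 'd.
       inj_on \<eta> {1..d} \<and>
       module.independent (scl E) (\<eta> ` {1..d}) \<and>
       module.span (scl E) (\<eta> ` {1..d}) = UNIV \<and>
       (\<forall>i\<in>{1..d}. isomonodromic_along E F \<phi> s (\<eta> i) sc N act)"
    then obtain d and \<eta> :: "nat \<Rightarrow> 'd" where "k.vs.span (\<eta> ` {1..d}) = UNIV"
      "\<forall>i\<in>{1..d}. isomonodromic_along E F \<phi> s (\<eta> i) sc N act" by blast
    then have "\<exists>x T. lifts x \<zeta> \<and> covariant x T" for \<zeta>
      by (elim covariant_exists) (blast intro: isomonodromic_along_imp_covariant)
    then show "isomonodromic E F \<phi> s sc N act"
      using assms(5) by (rule isomonodromic_if_covariant)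
  qed
qed

end
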